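(* Let $\alpha>0$ and let $f$ be a positive concave function on $[0,\infty)$ with the additional property that for some $\delta>0$ $$\int_0^\delta\frac{1}{f(u)(\log1/u)^{1/2}}\,du<\infty.$$ Let $\widetilde Z_{\alpha,f}=\{\widetilde Z_{\alpha,f}(t),t>0\}$ be the $\alpha$-permanental process, with continuous sample paths on $(0,\infty)$, with kernel $$\widetilde u_f(s,t)=s\wedge t+f(t),\qquad s,t>0.$$ Then there exists a coupling of $\widetilde Z_{\alpha,f}$ with a gamma random variable $\xi_{\alpha,1}$, with shape $\alpha$ and scale $1$, such that $$\lim_{t\to0}\frac{\widetilde Z_{\alpha,f}(t)}{f(t)}=\xi_{\alpha,1}\qquad a.s.$$
   Context: For $\alpha>0$, a random vector $(X_1,\dots,X_n)$ with nonnegative components is $\alpha$-permanental with kernel $U$ (a real $n\times n$ matrix) if $E\big(e^{-\sum_{i=1}^n s_iX_i}\big)=|I+US|^{-\alpha}$ for every diagonal matrix $S$ with positive diagonal entries $s_1,\dots,s_n$, where $|\cdot|$ denotes the determinant. A stochastic process $\{X_\alpha(t),t\in\mathcal T\}$ is an $\alpha$-permanental process with kernel $\{u(s,t),s,t\in\mathcal T\}$ if for all $t_1,\dots,t_n\in\mathcal T$ the vector $(X_\alpha(t_1),\dots,X_\alpha(t_n))$ is $\alpha$-permanental with kernel $\{u(t_i,t_j)\}_{i,j=1}^n$. For every positive concave $f$ on $(0,\infty)$, $\widetilde u_f$ is the kernel of an $\alpha$-permanental process for all $\alpha>0$. A positive concave function on $(0,\infty)$ is extended to $[0,\infty)$ by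 $f(0)=\lim_{t\downarrow0}f(t)$, and the extension is again called positive and concave (so $f(0)=0$ is allowed). The gamma random variable $\xi_{\alpha,1}$ has density $x^{\alpha-1}e^{-x}/\Gamma(\alpha)$ on $x>0$. A coupling means that the process and the random variable are realized on a common probability space with their given laws. *)

theory Defs
  imports "HOL-Probability.Probability" "Jordan_Normal_Form.Determinant"
begin

(* The left-hand side of the Laplace transform identity is positive, so the determinant is
   nonzero (0 powr a = 0); it depends continuously on s and tends to 1 as s tends to 0, hence it
   is positive. The behaviour of powr at negative arguments is therefore irrelevant. *)
definition permanental_vector ::
  "'a measure \<Rightarrow> real \<Rightarrow> nat \<Rightarrow> real mat \<Rightarrow> (nat \<Rightarrow> 'a \<Rightarrow> real) \<Rightarrow> bool" where
  "permanental_vector M \<alpha> n U X \<longleftrightarrow>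
     prob_space M \<and> U \<in> carrier_mat n n \<and>
     (\<forall>i<n. X i \<in> borel_measurable M \<and> (\<forall>\<omega>\<in>space M. 0 \<le> X i \<omega>)) \<and>
     (\<forall>s :: nat \<Rightarrow> real. (\<forall>i<n. 0 < s i) \<longrightarrow>
        (\<integral>\<omega>. exp (- (\<Sum>i<n. s i * X i \<omega>)) \<partial>M)
          = Determinant.det (1\<^sub>m n + U * mat_diag n s) powr (- \<alpha>))"

definition permanental_process ::
  "'a measure \<Rightarrow> real \<Rightarrow> 'i set \<Rightarrow> ('i \<Rightarrow> 'i \<Rightarrow> real) \<Rightarrow> ('i \<Rightarrow> 'a \<Rightarrow> real) \<Rightarrow> bool" where
  "permanental_process M \<alpha> T u X \<longleftrightarrow>
     (\<forall>n. \<forall>t :: nat \<Rightarrow> 'i. (\<forall>i<n. t i \<in> T) \<longrightarrow>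
        permanental_vector M \<alpha> n (Matrix.mat n n (\<lambda>(i, j). u (t i) (t j))) (\<lambda>i. X (t i)))"

definition continuous_paths :: "'a measure \<Rightarrow> real set \<Rightarrow> (real \<Rightarrow> 'a \<Rightarrow> real) \<Rightarrow> bool" where
  "continuous_paths M T X \<longleftrightarrow> (\<forall>\<omega>\<in>space M. continuous_on T (\<lambda>t. X t \<omega>))"

definition process_law ::
  "'a measure \<Rightarrow> 'i set \<Rightarrow> ('i \<Rightarrow> 'a \<Rightarrow> real) \<Rightarrow> ('i \<Rightarrow> real) measure" where
  "process_law M T X = distr M (\<Pi>\<^sub>M t\<in>T. (borel :: real measure)) (\<lambda>\<omega>. \<lambda>t\<in>T. X t \<omega>)"

(* Positivity is required on the open half-line only: f 0 is the right limit, which may be 0. *)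
definition positive_concave :: "(real \<Rightarrow> real) \<Rightarrow> bool" where
  "positive_concave f \<longleftrightarrow>
     concave_on {0<..} f \<and> (\<forall>t>0. 0 < f t) \<and> (f \<longlongrightarrow> f 0) (at_right 0)"

definition u_tilde :: "(real \<Rightarrow> real) \<Rightarrow> real \<Rightarrow> real \<Rightarrow> real" where
  "u_tilde f s t = min s t + f t"

definition gamma_density :: "real \<Rightarrow> real \<Rightarrow> real" where
  "gamma_density \<alpha> x = (if 0 < x then x powr (\<alpha> - 1) * exp (- x) / Gamma \<alpha> else 0)"

end

theory Submission
  imports Defs
begin

text \<open>Put \<open>G t = t + f t\<close>, the diagonal of the kernel, and \<open>W t = Z t / G t\<close>. The limit
\<open>\<xi>\<close> is constructed on the probability space that carries \<open>Z\<close>, as the almost sure limit of \<open>W t\<close>;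
the coupling then only transports the pair \<open>(Z, \<xi>)\<close> to the prescribed space
(\<open>coupling_of_AE_limit\<close>).

The heart of the matter is a computation with two by two determinants. For \<open>s < t\<close> the
pair \<open>(W s, W t)\<close> has the Laplace transform \<open>(1 + a + b + h a b)\<^sup>-\<^sup>\<alpha>\<close> with \<open>h = (t - s) / G t\<close>.
For \<open>h = 0\<close> this is the transform of \<open>(\<xi>, \<xi>)\<close> for a single gamma variable \<open>\<xi>\<close>, and in
general the transform forces the fourth moment of \<open>W s - W t\<close> to be at most a constant times
\<open>h\<^sup>2\<close> (\<open>fourth_moment_of_laplace\<close>). Formally, \<open>E exp (\<theta> (W t - W s)) = (1 - h \<theta>\<^sup>2)\<^sup>-\<^sup>\<alpha>\<close>, but the proof
stays with positive arguments: a fourth difference of the transform and Fatou's lemma are enough.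

Fourth moments are exactly what the integral condition can pay for. With
\<open>p k = 2\<^sup>-\<^sup>k / f (2\<^sup>-\<^sup>k)\<close>, comparing the integral with its dyadic blocks shows that
\<open>p k / sqrt (k + 1)\<close> is summable. Since \<open>t / f t\<close> is nondecreasing by concavity, \<open>p\<close> is nonincreasing, so
\<open>p k = O (1 / sqrt (k + 1))\<close>, and therefore the squares of \<open>p k\<close> are summable
(\<open>summable_square_of_weighted\<close>). Now \<open>E (W (2\<^sup>-\<^sup>k) - W s)\<^sup>4\<close> is of order \<open>(p k)\<^sup>2\<close> uniformly in \<open>s < 2\<^sup>-\<^sup>k\<close>, which gives
almost sure convergence along the powers of one half (\<open>AE_convergent_of_fourth_moments\<close>), and a chaining
argument bounds the fourth moment of the oscillation of \<open>W\<close> over a dyadic block by the same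
summable quantity (\<open>chaining_fourth_moment\<close>), which fills in all other \<open>t\<close>. Finally \<open>G t / f t\<close> tends to
\<open>1\<close>, so \<open>Z t / f t\<close> has the same limit as \<open>W t\<close>.

For every \<open>t\<close> the Laplace transform of \<open>W t\<close> is \<open>(1 + a)\<^sup>-\<^sup>\<alpha>\<close>. It passes to \<open>\<xi>\<close>, and a law on the half-line is
determined by its Laplace transform at the natural numbers, which are the moments of \<open>exp (- \<xi>)\<close>
(\<open>distributed_gamma_of_laplace\<close>).\<close>

section \<open>Positive concave functions and the integral condition\<close>

text \<open>If \<open>f\<close> decreased from \<open>s\<close> to \<open>t\<close>, then beyond \<open>t\<close> the graph would lie below a line of negative slope,
which takes the value \<open>0\<close> somewhere; this contradicts positivity.\<close>
lemma positive_concave_mono: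
  fixes f :: "real \<Rightarrow> real"
  assumes conc: "concave_on {0<..} f" and pos: "\<And>t. 0 < t \<Longrightarrow> 0 < f t"
    and "0 < s" "s \<le> t"
  shows "f s \<le> f t"
proof (rule ccontr)
  assume "\<not> f s \<le> f t"
  then have lt: "f t < f s" and st: "s < t"
    using assms(4) by (auto simp: not_le less_le)
  \<comment> \<open>the point where the line through \<open>(s, f s)\<close> and \<open>(t, f t)\<close> reaches the value \<open>0\<close>\<close>
  define u where "u = (t * f s - s * f t) / (f s - f t)"
  have u_eq: "u * (f s - f t) = t * f s - s * f t" using lt by (simp add: u_def)
  have "t * (f s - f t) < u * (f s - f t)"
    unfolding u_eq using st pos[of t] assms(3) by (simp add: algebra_simps)
  then have tu: "t < u" using lt by simp
  define c where "c = (t - s) / (u - s)"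
  have c: "0 < c" "c < 1" using st tu by (auto simp: c_def)
  have cus: "c * (u - s) = t - s" using st tu by (simp add: c_def)
  have "f ((1 - c) * s + c * u) \<ge> (1 - c) * f s + c * f u"
    using concave_onD[OF conc, of c s u] c assms(3) st tu by simp
  moreover have "(1 - c) * s + c * u = t" using cus by (simp add: algebra_simps)
  moreover have "(u - s) * ((1 - c) * f s) = (u - s) * f t"
  proof -
    have "(u - s) * ((1 - c) * f s) = (u - s) * f s - (c * (u - s)) * f s" by (simp add: algebra_simps)
    also have "\<dots> = (u - s) * f t" unfolding cus using u_eq by (simp add: algebra_simps)
    finally show ?thesis .
  qed
  ultimately have "f t \<ge> f t + c * f u" using tu st by simp
  then show False using mult_pos_pos[OF c(1) pos[of u]] tu st assms(3) by simp
qed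

text \<open>The slope of the chord from a point near the origin to \<open>(t, f t)\<close> bounds \<open>f s\<close> from below. As \<open>f\<close> is
positive, its value near the origin can be dropped, and the left end of the chord tends to \<open>0\<close>.\<close>
lemma positive_concave_ratio_mono:
  fixes f :: "real \<Rightarrow> real"
  assumes conc: "concave_on {0<..} f" and pos: "\<And>t. 0 < t \<Longrightarrow> 0 < f t"
    and "0 < s" "s \<le> t"
  shows "s / f s \<le> t / f t"
proof -
  have "(s - r) * f t \<le> (t - r) * f s" if r: "0 < r" "r < s" for r
  proof -
    define c where "c = (s - r) / (t - r)"
    have c: "0 < c" "c \<le> 1" using r assms by (auto simp: c_def)
    have ctr: "c * (t - r) = s - r" using r assms by (simp add: c_def)
    have "f ((1 - c) * r + c * t) \<ge> (1 - c) * f r + c * f t"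
      using concave_onD[OF conc, of c r t] c assms r by simp
    moreover have "(1 - c) * r + c * t = s" using ctr by (simp add: algebra_simps)
    moreover have "0 \<le> (1 - c) * f r" using c pos[of r] r by simp
    ultimately have "c * f t \<le> f s" by simp
    then have "(t - r) * (c * f t) \<le> (t - r) * f s" using r assms by (intro mult_left_mono) auto
    then show ?thesis using ctr by (metis mult.assoc mult.commute)
  qed
  then have "eventually (\<lambda>r. (s - r) * f t \<le> (t - r) * f s) (at_right 0)"
    unfolding eventually_at_right_field using assms(3) by blast
  then have "(s - 0) * f t \<le> (t - 0) * f s"
    by (intro tendsto_le[OF _ _ _, of "at_right (0::real)" "\<lambda>r. (t - r) * f s" _ "\<lambda>r. (s - r) * f t"]
        tendsto_intros) auto
  then show ?thesis using pos[of s] pos[of t] assms(3,4) by (simp add: field_simps)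
qed

text \<open>By monotonicity the first \<open>k + 1\<close> weighted terms are each at least \<open>q k / sqrt (k + 1)\<close>, so that
\<open>q k * sqrt (k + 1)\<close> is bounded by the whole sum. One factor \<open>q k\<close> of the square is thus traded for the weight.\<close>
lemma summable_square_of_weighted:
  fixes q :: "nat \<Rightarrow> real"
  assumes nonneg: "\<And>k. 0 \<le> q k" and anti: "antimono q"
    and summ: "summable (\<lambda>k. q k / sqrt (real k + 1))"
  shows "summable (\<lambda>k. (q k)\<^sup>2)"
proof -
  define B where "B = (\<Sum>k. q k / sqrt (real k + 1))"
  have bound: "q k * sqrt (real k + 1) \<le> B" for k
  proof -
    have "q k * sqrt (real k + 1) = (\<Sum>j<Suc k. q k / sqrt (real k + 1))"
      by (simp add: field_simps)
    also have "\<dots> \<le> (\<Sum>j<Suc k. q j / sqrt (real j + 1))"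
      using nonneg by (intro sum_mono frac_le) (auto intro: antimonoD[OF anti])
    also have "\<dots> \<le> B"
      unfolding B_def using nonneg by (intro sum_le_suminf summ) auto
    finally show ?thesis .
  qed
  have "(q k)\<^sup>2 \<le> B * (q k / sqrt (real k + 1))" for k
  proof -
    have "(q k)\<^sup>2 = (q k * sqrt (real k + 1)) * (q k / sqrt (real k + 1))"
      by (simp add: power2_eq_square)
    also have "\<dots> \<le> B * (q k / sqrt (real k + 1))"
      using nonneg by (intro mult_right_mono bound) auto
    finally show ?thesis .
  qed
  then show ?thesis
    by (intro summable_comparison_test'[OF summable_mult[OF summ, of B], of 0]) auto
qed

text \<open>On the block between \<open>(1/2)^Suc k\<close> and \<open>(1/2)^k\<close> the integrand is at least its value with \<open>g\<close> taken at the right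
end and \<open>ln (1 / u)\<close> replaced by \<open>k + 1\<close>; the length of the block is half of \<open>(1/2)^k\<close>. The comparison is with a step function,
whose integral is the series.\<close>
lemma dyadic_summable_of_integral:
  fixes g :: "real \<Rightarrow> real"
  assumes mono: "\<And>s t. 0 < s \<Longrightarrow> s \<le> t \<Longrightarrow> g s \<le> g t" and pos: "\<And>t. 0 < t \<Longrightarrow> 0 < g t"
    and \<delta>: "0 < \<delta>"
    and fin: "(\<integral>\<^sup>+u\<in>{0<..<\<delta>}. ennreal (1 / (g u * sqrt (ln (1 / u)))) \<partial>lborel) < \<infinity>"
  shows "summable (\<lambda>k. (1/2)^k / g ((1/2)^k) / sqrt (real k + 1))"
proof -
  define p where "p = (\<lambda>k. (1/2)^k / g ((1/2)^k) / sqrt (real k + 1))"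
  have p0: "0 \<le> p k" for k unfolding p_def using less_imp_le[OF pos[of "(1/2)^k"]] by simp
  obtain k0 where k0: "(1/2::real)^k0 < \<delta>" using real_arch_pow_inv[OF \<delta>, of "1/2"] by auto
  define I where "I = (\<lambda>k. {(1/2::real)^Suc k<..<(1/2)^k})"
  have disj: "disjoint_family (\<lambda>k. I (k + k0))"
  proof -
    have "I i \<inter> I j = {}" if "i < j" for i j
    proof -
      have "(1/2::real)^j \<le> (1/2)^Suc i" using that by (intro power_decreasing) auto
      then show ?thesis by (auto simp: I_def)
    qed
    then show ?thesis unfolding disjoint_family_on_def
      by (metis add_right_cancel inf_commute linorder_neqE_nat)
  qed
  define h where "h = (\<lambda>u. ennreal (1 / (g u * sqrt (ln (1 / u)))))"
  define c where "c = (\<lambda>k. 1 / (g ((1/2)^k) * sqrt (real k + 1)))"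
  have le: "c k \<le> 1 / (g u * sqrt (ln (1 / u)))" if u: "u \<in> I k" for u k
  proof -
    have u0: "0 < u" "u < 1" "u \<le> (1/2)^k" "(1/2)^Suc k < u"
      using u power_le_one[of "1/2::real" k] less_trans[OF zero_less_power[of "1/2::real" "Suc k"], of u]
      by (auto simp: I_def simp del: power_Suc)
    have "1 / u \<le> 2 ^ Suc k" using u0 by (simp add: field_simps power_divide)
    then have "ln (1 / u) \<le> ln (2 ^ Suc k)" using u0 by (subst ln_le_cancel_iff) auto
    also have "\<dots> = (real k + 1) * ln 2" by (simp add: ln_realpow del: power_Suc)
    also have "\<dots> \<le> (real k + 1) * 1" using ln_2_less_1 by (intro mult_left_mono) auto
    finally have a: "ln (1 / u) \<le> real k + 1" by simp
    have b: "0 < ln (1 / u)" using u0 by simp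
    show ?thesis
      unfolding c_def using a b u0 pos[of u] mono[of u "(1/2)^k"]
      by (intro divide_left_mono mult_mono mult_pos_pos) auto
  qed
  have c0: "0 \<le> c k" for k unfolding c_def using less_imp_le[OF pos[of "(1/2)^k"]] by simp
  have eq: "ennreal (p k / 2) = (\<integral>\<^sup>+u. ennreal (c k) * indicator (I k) u \<partial>lborel)" for k
  proof -
    have "ennreal (p k / 2) = ennreal (c k) * ennreal ((1/2)^Suc k)"
      using c0[of k] by (subst ennreal_mult[symmetric]) (auto simp: p_def c_def)
    also have "\<dots> = ennreal (c k) * emeasure lborel (I k)" by (simp add: I_def)
    also have "\<dots> = (\<integral>\<^sup>+u. ennreal (c k) * indicator (I k) u \<partial>lborel)"
      by (subst nn_integral_cmult_indicator) (auto simp: I_def)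
    finally show ?thesis .
  qed
  have "(\<Sum>k. ennreal (p (k + k0) / 2))
      = (\<integral>\<^sup>+u. (\<Sum>k. ennreal (c (k + k0)) * indicator (I (k + k0)) u) \<partial>lborel)"
    unfolding eq by (rule nn_integral_suminf[symmetric]) (auto simp: I_def)
  also have "\<dots> \<le> (\<integral>\<^sup>+u\<in>{0<..<\<delta>}. h u \<partial>lborel)"
  proof (intro nn_integral_mono)
    fix u :: real
    show "(\<Sum>k. ennreal (c (k + k0)) * indicator (I (k + k0)) u) \<le> h u * indicator {0<..<\<delta>} u"
    proof (cases "\<exists>k. u \<in> I (k + k0)")
      case True
      then obtain k where k: "u \<in> I (k + k0)" by blast
      have "u < (1/2)^(k + k0)" using k by (simp add: I_def)
      also have "\<dots> \<le> (1/2)^k0" by (rule power_decreasing) auto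
      also note k0
      finally have "u \<in> {0<..<\<delta>}"
        using k less_trans[OF zero_less_power[of "1/2::real" "Suc (k + k0)"], of u]
        by (simp add: I_def del: power_Suc)
      moreover have "u \<notin> I (j + k0)" if "j \<noteq> k" for j
        using disj k that by (auto simp: disjoint_family_on_def)
      then have "(\<Sum>j. ennreal (c (j + k0)) * indicator (I (j + k0)) u)
          = (\<Sum>j\<in>{k}. ennreal (c (j + k0)) * indicator (I (j + k0)) u)"
        by (intro suminf_finite) auto
      ultimately show ?thesis using le[OF k] k by (auto simp: h_def intro!: ennreal_leI)
    next
      case False
      then show ?thesis by simp
    qed
  qed
  also have "\<dots> < \<infinity>" using fin by (simp add: h_def)
  finally have "summable (\<lambda>k. p (k + k0) / 2)"
    using p0 by (intro summable_suminf_not_top) auto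
  then have "summable (\<lambda>k. p (k + k0))" using summable_mult[of "\<lambda>k. p (k + k0) / 2" 2] by simp
  then show ?thesis unfolding p_def using summable_iff_shift by blast
qed

section \<open>Fourth moments from a bivariate Laplace transform\<close>

text \<open>The coefficients \<open>6, -8, 2\<close> annihilate affine functions of the nodes \<open>0, 1, 4\<close>, so only the
second derivative of \<open>(B - y * \<delta>) powr (-\<alpha>)\<close> contributes. By convexity the remainder at \<open>y = 1\<close> has the favourable sign,
and the one at \<open>y = 4\<close> gives the constant \<open>16\<close>.\<close>
lemma second_order_bound:
  fixes \<alpha> \<delta> B :: real
  assumes "0 < \<alpha>" "0 \<le> \<delta>" "1 \<le> B - 4 * \<delta>"
  shows "6 * B powr (-\<alpha>) - 8 * (B - \<delta>) powr (-\<alpha>) + 2 * (B - 4 * \<delta>) powr (-\<alpha>)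
    \<le> 16 * \<alpha> * (\<alpha> + 1) * \<delta>\<^sup>2"
proof -
  define \<phi> where "\<phi> = (\<lambda>m y. if m = 0 then (B - y * \<delta>) powr (-\<alpha>)
    else if m = Suc 0 then \<alpha> * \<delta> * (B - y * \<delta>) powr (-\<alpha> - 1)
    else \<alpha> * (\<alpha> + 1) * \<delta>\<^sup>2 * (B - y * \<delta>) powr (-\<alpha> - 2))"
  have base: "1 \<le> B - y * \<delta>" if "0 \<le> y" "y \<le> 4" for y
    using mult_right_mono[OF that(2) assms(2)] assms(3) by simp
  have der: "(\<phi> m has_real_derivative \<phi> (Suc m) y) (at y)" if "m < 2" "0 \<le> y" "y \<le> 4" for m y
  proof -
    have "0 < B - y * \<delta>" using base[OF that(2,3)] by simp
    moreover have "m = 0 \<or> m = Suc 0" using that by auto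
    ultimately show ?thesis
      unfolding \<phi>_def
      by (auto intro!: derivative_eq_intros simp: power2_eq_square algebra_simps)
  qed
  have taylor: "\<exists>t>0. t < x \<and> \<phi> 0 x = \<phi> 0 0 + \<phi> 1 0 * x + \<phi> 2 t / 2 * x\<^sup>2" if "0 < x" "x \<le> 4" for x
    using Maclaurin[of x 2 \<phi> "\<phi> 0"] der that
    by (auto simp: numeral_2_eq_2)
  have rem: "0 \<le> \<phi> 2 t" "\<phi> 2 t \<le> \<alpha> * (\<alpha> + 1) * \<delta>\<^sup>2" if "0 < t" "t < 4" for t
  proof -
    have "(B - t * \<delta>) powr (-\<alpha> - 2) \<le> 1"
      using powr_mono[of "-\<alpha> - 2" 0 "B - t * \<delta>"] base[of t] that assms(1) by simp
    then show "\<phi> 2 t \<le> \<alpha> * (\<alpha> + 1) * \<delta>\<^sup>2" "0 \<le> \<phi> 2 t"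
      using assms(1) by (auto simp: \<phi>_def intro!: mult_right_le_one_le)
  qed
  obtain t1 where t1: "0 < t1" "t1 < 1" "\<phi> 0 1 = \<phi> 0 0 + \<phi> 1 0 + \<phi> 2 t1 / 2"
    using taylor[of 1] by auto
  obtain t4 where t4: "0 < t4" "t4 < 4" "\<phi> 0 4 = \<phi> 0 0 + \<phi> 1 0 * 4 + \<phi> 2 t4 * 8"
    using taylor[of 4] by auto
  have "6 * \<phi> 0 0 - 8 * \<phi> 0 1 + 2 * \<phi> 0 4 \<le> 16 * (\<alpha> * (\<alpha> + 1) * \<delta>\<^sup>2)"
    using t1 t4 rem[of t1] rem[of t4] by simp
  then show ?thesis by (simp add: \<phi>_def)
qed

text \<open>The difference of \<open>exp (- \<epsilon> X)\<close> and \<open>exp (- \<epsilon> Y)\<close>, divided by \<open>\<epsilon>\<close>, tends to \<open>Y - X\<close>. The fourth power of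
this quotient, multiplied by \<open>exp (- \<epsilon> (X + Y))\<close>, expands into exponentials with
positive weights \<open>(5,1), (4,2), (3,3), (2,4), (1,5)\<close> only, where the Laplace transform is known; the extra factor is there
to avoid the weight \<open>0\<close>. The weights have constant sum \<open>6\<close>
and products \<open>5, 8, 9, 8, 5\<close>, so the binomial coefficients \<open>1, -4, 6, -4, 1\<close> collapse to
the combination of \<open>second_order_bound\<close>, with a bound that does not depend on \<open>\<epsilon>\<close>. Fatou's lemma concludes.\<close>
lemma (in prob_space) fourth_moment_of_laplace:
  fixes X Y :: "'a \<Rightarrow> real"
  assumes X[measurable]: "X \<in> borel_measurable M" and Y[measurable]: "Y \<in> borel_measurable M"
    and nonneg: "\<And>\<omega>. \<omega> \<in> space M \<Longrightarrow> 0 \<le> X \<omega>" "\<And>\<omega>. \<omega> \<in> space M \<Longrightarrow> 0 \<le> Y \<omega>"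
    and \<alpha>: "0 < \<alpha>" and h: "0 \<le> h"
    and laplace: "\<And>a b. 0 < a \<Longrightarrow> 0 < b \<Longrightarrow>
      (\<integral>\<omega>. exp (- (a * X \<omega> + b * Y \<omega>)) \<partial>M) = (1 + a + b + h * a * b) powr (-\<alpha>)"
  shows "(\<integral>\<^sup>+\<omega>. ennreal ((X \<omega> - Y \<omega>)^4) \<partial>M) \<le> ennreal (16 * \<alpha> * (\<alpha> + 1) * h\<^sup>2)"
proof -
  define \<Phi> where "\<Phi> = (\<lambda>\<epsilon> \<omega>. ((exp (- (\<epsilon> * X \<omega>)) - exp (- (\<epsilon> * Y \<omega>))) / \<epsilon>)^4 * exp (- (\<epsilon> * (X \<omega> + Y \<omega>))))"
  have \<Phi>_nonneg: "0 \<le> \<Phi> \<epsilon> \<omega>" for \<epsilon> \<omega> by (simp add: \<Phi>_def)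
  have [measurable]: "\<Phi> \<epsilon> \<in> borel_measurable M" for \<epsilon> unfolding \<Phi>_def by measurable
  have bound: "(\<integral>\<^sup>+\<omega>. ennreal (\<Phi> \<epsilon> \<omega>) \<partial>M) \<le> ennreal (16 * \<alpha> * (\<alpha> + 1) * h\<^sup>2)" if \<epsilon>: "0 < \<epsilon>" for \<epsilon>
  proof -
    define E where "E = (\<lambda>i j \<omega>. exp (- ((i * \<epsilon>) * X \<omega> + (j * \<epsilon>) * Y \<omega>)))"
    have intE: "integrable M (E i j)" if "0 < i" "0 < j" for i j
    proof (rule integrable_const_bound[of _ 1])
      have "norm (E i j \<omega>) \<le> 1" if "\<omega> \<in> space M" for \<omega>
      proof -
        have "0 \<le> i * \<epsilon> * X \<omega> + j * \<epsilon> * Y \<omega>"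
          using nonneg[OF that] \<open>0 < i\<close> \<open>0 < j\<close> \<epsilon>
          by (intro add_nonneg_nonneg mult_nonneg_nonneg) auto
        then show ?thesis
          by (simp only: E_def real_norm_def abs_exp_cancel exp_le_one_iff neg_le_0_iff_le)
      qed
      then show "AE \<omega> in M. norm (E i j \<omega>) \<le> 1" by (intro AE_I2)
    qed (simp add: E_def)
    have lapE: "(\<integral>\<omega>. E i j \<omega> \<partial>M) = (1 + (i + j) * \<epsilon> + h * \<epsilon>\<^sup>2 * (i * j)) powr (-\<alpha>)"
      if "0 < i" "0 < j" for i j
      using laplace[of "i * \<epsilon>" "j * \<epsilon>"] that \<epsilon> by (simp add: E_def algebra_simps power2_eq_square)
    have expand: "\<Phi> \<epsilon> \<omega> = (1 / \<epsilon>^4) * (E 5 1 \<omega> - 4 * E 4 2 \<omega> + 6 * E 3 3 \<omega> - 4 * E 2 4 \<omega> + E 1 5 \<omega>)" for \<omega>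
    proof -
      define x y where "x = exp (- (\<epsilon> * X \<omega>))" and "y = exp (- (\<epsilon> * Y \<omega>))"
      have E: "E (real i) (real j) \<omega> = x^i * y^j" for i j
        by (simp add: E_def x_def y_def exp_of_nat_mult[symmetric] exp_add[symmetric] algebra_simps)
      have "\<Phi> \<epsilon> \<omega> = (1 / \<epsilon>^4) * ((x - y)^4 * (x * y))"
        by (simp add: \<Phi>_def x_def y_def exp_add[symmetric] power_divide algebra_simps)
      also have "(x - y)^4 = x^4 - 4 * (x^3 * y) + 6 * (x^2 * y^2) - 4 * (x * y^3) + y^4"
        by (simp add: power4_eq_xxxx power3_eq_cube power2_eq_square algebra_simps)
      also have "(x^4 - 4 * (x^3 * y) + 6 * (x^2 * y^2) - 4 * (x * y^3) + y^4) * (x * y)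
          = x^5 * y - 4 * (x^4 * y^2) + 6 * (x^3 * y^3) - 4 * (x^2 * y^4) + x * y^5"
        by (simp add: power4_eq_xxxx power3_eq_cube power2_eq_square power_numeral_odd
            power_numeral_even algebra_simps)
      also have "x^5 * y = E 5 1 \<omega>" using E[of 5 1] by simp
      also have "x^4 * y^2 = E 4 2 \<omega>" using E[of 4 2] by simp
      also have "x^3 * y^3 = E 3 3 \<omega>" using E[of 3 3] by simp
      also have "x^2 * y^4 = E 2 4 \<omega>" using E[of 2 4] by simp
      also have "x * y^5 = E 1 5 \<omega>" using E[of 1 5] by simp
      finally show ?thesis .
    qed
    \<comment> \<open>with \<open>\<delta> = h * \<epsilon>\<^sup>2\<close>, the products 9, 8, 5 correspond to \<open>B\<close>, \<open>B - \<delta>\<close>, \<open>B - 4 * \<delta>\<close>\<close>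
    define B where "B = 1 + 6 * \<epsilon> + 9 * (h * \<epsilon>\<^sup>2)"
    have E51: "(\<integral>\<omega>. E 5 1 \<omega> \<partial>M) = (B - 4 * (h * \<epsilon>\<^sup>2)) powr (-\<alpha>)"
      and E15: "(\<integral>\<omega>. E 1 5 \<omega> \<partial>M) = (B - 4 * (h * \<epsilon>\<^sup>2)) powr (-\<alpha>)"
      and E42: "(\<integral>\<omega>. E 4 2 \<omega> \<partial>M) = (B - h * \<epsilon>\<^sup>2) powr (-\<alpha>)"
      and E24: "(\<integral>\<omega>. E 2 4 \<omega> \<partial>M) = (B - h * \<epsilon>\<^sup>2) powr (-\<alpha>)"
      and E33: "(\<integral>\<omega>. E 3 3 \<omega> \<partial>M) = B powr (-\<alpha>)"
      using lapE[of 5 1] lapE[of 1 5] lapE[of 4 2] lapE[of 2 4] lapE[of 3 3] by (simp_all add: B_def mult_ac add_ac)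
    have "(\<integral>\<omega>. \<Phi> \<epsilon> \<omega> \<partial>M) = (1 / \<epsilon>^4) * ((\<integral>\<omega>. E 5 1 \<omega> \<partial>M) - 4 * (\<integral>\<omega>. E 4 2 \<omega> \<partial>M)
      + 6 * (\<integral>\<omega>. E 3 3 \<omega> \<partial>M) - 4 * (\<integral>\<omega>. E 2 4 \<omega> \<partial>M) + (\<integral>\<omega>. E 1 5 \<omega> \<partial>M))"
      unfolding expand using intE[of 5 1] intE[of 4 2] intE[of 3 3] intE[of 2 4] intE[of 1 5] by simp
    also have "\<dots> = (1 / \<epsilon>^4) *
      (6 * B powr (-\<alpha>) - 8 * (B - h * \<epsilon>\<^sup>2) powr (-\<alpha>) + 2 * (B - 4 * (h * \<epsilon>\<^sup>2)) powr (-\<alpha>))"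
      unfolding E51 E15 E42 E24 E33 by simp
    also have "\<dots> \<le> (1 / \<epsilon>^4) * (16 * \<alpha> * (\<alpha> + 1) * (h * \<epsilon>\<^sup>2)\<^sup>2)"
      using \<alpha> h \<epsilon> by (intro mult_left_mono second_order_bound) (auto simp: B_def)
    also have "(h * \<epsilon>\<^sup>2)\<^sup>2 = h\<^sup>2 * \<epsilon>^4" by (simp add: power_mult_distrib)
    also have "(1 / \<epsilon>^4) * (16 * \<alpha> * (\<alpha> + 1) * (h\<^sup>2 * \<epsilon>^4)) = 16 * \<alpha> * (\<alpha> + 1) * h\<^sup>2"
      using \<epsilon> by simp
    finally have "(\<integral>\<omega>. \<Phi> \<epsilon> \<omega> \<partial>M) \<le> 16 * \<alpha> * (\<alpha> + 1) * h\<^sup>2" .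
    moreover have "integrable M (\<Phi> \<epsilon>)"
      unfolding expand[abs_def] using intE[of 5 1] intE[of 4 2] intE[of 3 3] intE[of 2 4] intE[of 1 5] by simp
    ultimately show ?thesis
      using \<Phi>_nonneg by (simp add: nn_integral_eq_integral ennreal_leI)
  qed
  have lim: "(\<lambda>n. ennreal (\<Phi> (1 / real (Suc n)) \<omega>)) \<longlonglongrightarrow> ennreal ((X \<omega> - Y \<omega>)^4)" for \<omega>
  proof -
    have "((\<lambda>\<epsilon>. (exp (- (\<epsilon> * x)) - exp (- (\<epsilon> * y))) / \<epsilon>) \<longlongrightarrow> y - x) (at 0)" for x y :: real
    proof -
      have "((\<lambda>\<epsilon>. exp (- (\<epsilon> * x)) - exp (- (\<epsilon> * y))) has_real_derivative (y - x)) (at 0)"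
        by (auto intro!: derivative_eq_intros)
      then show ?thesis by (simp add: has_field_derivative_iff)
    qed
    then have "((\<lambda>\<epsilon>. \<Phi> \<epsilon> \<omega>) \<longlongrightarrow> (Y \<omega> - X \<omega>)^4 * exp (- (0 * (X \<omega> + Y \<omega>)))) (at 0)"
      unfolding \<Phi>_def by (intro tendsto_intros)
    then have "((\<lambda>\<epsilon>. \<Phi> \<epsilon> \<omega>) \<longlongrightarrow> (X \<omega> - Y \<omega>)^4) (at 0)"
      using power_even_abs[of 4 "X \<omega> - Y \<omega>"] power_even_abs[of 4 "Y \<omega> - X \<omega>"]
      by (simp add: abs_minus_commute)
    moreover have "filterlim (\<lambda>n. 1 / real (Suc n)) (at 0) sequentially"
      using LIMSEQ_inverse_real_of_nat by (auto simp: filterlim_at inverse_eq_divide)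
    ultimately have "(\<lambda>n. \<Phi> (1 / real (Suc n)) \<omega>) \<longlonglongrightarrow> (X \<omega> - Y \<omega>)^4" by (rule filterlim_compose)
    then show ?thesis by (rule tendsto_ennrealI)
  qed
  have "(\<integral>\<^sup>+\<omega>. ennreal ((X \<omega> - Y \<omega>)^4) \<partial>M)
      = (\<integral>\<^sup>+\<omega>. liminf (\<lambda>n. ennreal (\<Phi> (1 / real (Suc n)) \<omega>)) \<partial>M)"
    using lim by (intro nn_integral_cong) (metis lim_imp_Liminf sequentially_bot)
  also have "\<dots> \<le> liminf (\<lambda>n. \<integral>\<^sup>+\<omega>. ennreal (\<Phi> (1 / real (Suc n)) \<omega>) \<partial>M)"
    by (intro nn_integral_liminf) measurable
  also have "\<dots> \<le> ennreal (16 * \<alpha> * (\<alpha> + 1) * h\<^sup>2)"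
    using bound by (intro Liminf_le) auto
  finally show ?thesis .
qed

section \<open>One- and two-dimensional marginals of permanental processes\<close>

lemma det_two:
  fixes A :: "'a::comm_ring_1 mat"
  assumes "A \<in> carrier_mat 2 2"
  shows "Determinant.det A = A $$ (0,0) * A $$ (1,1) - A $$ (0,1) * A $$ (1,0)"
proof -
  have "{0..<2::nat} = {0, 1}" by auto
  then have "{p. p permutes {0..<2::nat}} = {id, Transposition.transpose 0 1}"
    by (auto simp: permutes_doubleton_iff)
  moreover have "id \<noteq> Transposition.transpose 0 (1::nat)"
    by (metis id_apply transpose_apply_first zero_neq_one)
  ultimately show ?thesis
    by (simp add: det_def'[OF assms] signof_id sign_swap_id sign_id eval_nat_numeral)
qed

lemma permanental_process_laplace_one:
  assumes X: "permanental_process M \<alpha> T u X" and t: "t \<in> T" and a: "0 < a"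
  shows "(\<integral>\<omega>. exp (- (a * X t \<omega>)) \<partial>M) = (1 + a * u t t) powr (-\<alpha>)"
proof -
  let ?U = "Matrix.mat 1 1 (\<lambda>(i, j). u t t)"
  have "permanental_vector M \<alpha> 1 ?U (\<lambda>i. X t)"
    using X t unfolding permanental_process_def by (elim allE[of _ 1] allE[of _ "\<lambda>_. t"]) simp
  then have "(\<integral>\<omega>. exp (- (a * X t \<omega>)) \<partial>M)
      = Determinant.det (1\<^sub>m 1 + ?U * mat_diag 1 (\<lambda>_. a)) powr (-\<alpha>)"
    unfolding permanental_vector_def using a by (auto dest!: spec[of _ "\<lambda>_. a"])
  also have "Determinant.det (1\<^sub>m 1 + ?U * mat_diag 1 (\<lambda>_. a)) = 1 + a * u t t"
    by (subst det_single) (auto simp: mat_diag_mult_right[of _ 1])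
  finally show ?thesis .
qed

lemma permanental_process_laplace_two:
  assumes X: "permanental_process M \<alpha> T u X" and st: "s \<in> T" "t \<in> T" and ab: "0 < a" "0 < b"
  shows "(\<integral>\<omega>. exp (- (a * X s \<omega> + b * X t \<omega>)) \<partial>M)
    = ((1 + a * u s s) * (1 + b * u t t) - a * b * u s t * u t s) powr (-\<alpha>)"
proof -
  let ?p = "\<lambda>i::nat. if i = 0 then s else t" and ?c = "\<lambda>i::nat. if i = 0 then a else b"
  let ?U = "Matrix.mat 2 2 (\<lambda>(i, j). u (?p i) (?p j))"
  have "permanental_vector M \<alpha> 2 ?U (\<lambda>i. X (?p i))"
    using X st unfolding permanental_process_def by (elim allE[of _ 2] allE[of _ ?p]) simp
  then have "(\<integral>\<omega>. exp (- (\<Sum>i<2. ?c i * X (?p i) \<omega>)) \<partial>M)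
      = Determinant.det (1\<^sub>m 2 + ?U * mat_diag 2 ?c) powr (-\<alpha>)"
    unfolding permanental_vector_def using ab by (auto dest!: spec[of _ ?c])
  moreover have "(\<Sum>i<2. ?c i * X (?p i) \<omega>) = a * X s \<omega> + b * X t \<omega>" for \<omega>
    by (simp add: eval_nat_numeral)
  moreover have "Determinant.det (1\<^sub>m 2 + ?U * mat_diag 2 ?c)
      = (1 + a * u s s) * (1 + b * u t t) - a * b * u s t * u t s"
    by (subst det_two) (auto simp: mat_diag_mult_right[of _ 2] mult_ac)
  ultimately show ?thesis by simp
qed

lemma permanental_process_prob_space: "permanental_process M \<alpha> T u X \<Longrightarrow> prob_space M"
  unfolding permanental_process_def permanental_vector_def by (elim allE[of _ 0]) auto

lemma permanental_process_measurable:
  assumes "permanental_process M \<alpha> T u X" "t \<in> T"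
  shows "X t \<in> borel_measurable M" "\<And>\<omega>. \<omega> \<in> space M \<Longrightarrow> 0 \<le> X t \<omega>"
proof -
  have "permanental_vector M \<alpha> 1 (Matrix.mat 1 1 (\<lambda>(i, j). u t t)) (\<lambda>i. X t)"
    using assms unfolding permanental_process_def by (elim allE[of _ 1] allE[of _ "\<lambda>_. t"]) simp
  then show "X t \<in> borel_measurable M" "\<And>\<omega>. \<omega> \<in> space M \<Longrightarrow> 0 \<le> X t \<omega>"
    unfolding permanental_vector_def by auto
qed

section \<open>Almost sure convergence and dyadic chaining\<close>

lemma AE_tendsto_zero_of_summable_integrals:
  fixes Y :: "nat \<Rightarrow> 'a \<Rightarrow> ennreal"
  assumes [measurable]: "\<And>k. Y k \<in> borel_measurable M"
    and fin: "(\<Sum>k. \<integral>\<^sup>+\<omega>. Y k \<omega> \<partial>M) < \<infinity>"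
  shows "AE \<omega> in M. (\<lambda>k. Y k \<omega>) \<longlonglongrightarrow> 0"
proof -
  have "(\<integral>\<^sup>+\<omega>. (\<Sum>k. Y k \<omega>) \<partial>M) = (\<Sum>k. \<integral>\<^sup>+\<omega>. Y k \<omega> \<partial>M)"
    by (rule nn_integral_suminf) simp
  then have "AE \<omega> in M. (\<Sum>k. Y k \<omega>) \<noteq> \<infinity>"
    using fin by (intro nn_integral_PInf_AE) auto
  then show ?thesis
  proof eventually_elim
    case (elim \<omega>)
    have ne: "Y k \<omega> \<noteq> \<infinity>" for k
      using elim sum_le_suminf[OF summableI, of "{k}" "\<lambda>k. Y k \<omega>"] by (auto simp: top_unique)
    define y where "y k = enn2real (Y k \<omega>)" for k
    have Y: "Y k \<omega> = ennreal (y k)" and y0: "0 \<le> y k" for k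
      using ne[of k] by (auto simp: y_def top.not_eq_extremum)
    have "summable y" using elim y0 unfolding Y by (intro summable_suminf_not_top) auto
    then have "(\<lambda>k. ennreal (y k)) \<longlonglongrightarrow> ennreal 0"
      by (intro tendsto_ennrealI summable_LIMSEQ_zero)
    then show ?case by (simp add: Y)
  qed
qed

lemma tendsto_zero_of_fourth_power:
  fixes d :: "'b \<Rightarrow> real"
  assumes "((\<lambda>k. ennreal ((d k)^4)) \<longlongrightarrow> 0) F"
  shows "(d \<longlongrightarrow> 0) F"
proof -
  have "((\<lambda>k. (d k)^4) \<longlongrightarrow> 0) F" using assms tendsto_enn2real[of "\<lambda>k. ennreal ((d k)^4)" 0 F] by simp
  then have "((\<lambda>k. root 4 ((d k)^4)) \<longlongrightarrow> root 4 0) F" by (rule tendsto_real_root)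
  moreover have "root 4 ((d k)^4) = \<bar>d k\<bar>" for k
    using real_root_power_cancel[of 4 "\<bar>d k\<bar>"] by (simp add: power_even_abs)
  ultimately show ?thesis by (simp add: tendsto_rabs_zero_iff)
qed

text \<open>Along a subsequence \<open>n\<close> with \<open>e (n j) \<le> (1/32)^j\<close>, even the fourth moments of \<open>2^j\<close> times the increments are summable,
so the increments are eventually below \<open>(1/2)^j\<close> and the subsequence converges.
Comparing \<open>X k\<close> with the later member \<open>X (n k)\<close> of the subsequence costs at most \<open>e k\<close>, which is summable
by assumption, so the full sequence follows.\<close>
lemma AE_convergent_of_fourth_moments:
  fixes X :: "nat \<Rightarrow> 'a \<Rightarrow> real"
  assumes [measurable]: "\<And>k. X k \<in> borel_measurable M"
    and mom: "\<And>k n. k \<le> n \<Longrightarrow> (\<integral>\<^sup>+\<omega>. ennreal ((X k \<omega> - X n \<omega>)^4) \<partial>M) \<le> ennreal (e k)"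
    and e: "\<And>k. 0 \<le> e k" "summable e"
  shows "AE \<omega> in M. convergent (\<lambda>k. X k \<omega>)"
proof -
  have "\<exists>N. \<forall>k\<ge>N. e k \<le> (1/32)^j" for j
    using order_tendstoD(2)[OF summable_LIMSEQ_zero[OF e(2)], of "(1/32)^j"]
    by (auto simp: eventually_sequentially intro: less_imp_le)
  then obtain N where N: "\<And>j k. N j \<le> k \<Longrightarrow> e k \<le> (1/32)^j" by metis
  define n where "n j = j + (\<Sum>i\<le>j. N i)" for j
  have n_ge: "j \<le> n j" "n j \<le> n (Suc j)" for j by (auto simp: n_def)
  have "N j \<le> n j" for j
    unfolding n_def using member_le_sum[of j "{..j}" N] by (simp add: trans_le_add2)
  then have e_n: "e (n j) \<le> (1/32)^j" for j using N by blast
  have fin: "(\<Sum>j. \<integral>\<^sup>+\<omega>. f j \<omega> \<partial>M) < \<infinity>"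
    if "\<And>j. (\<integral>\<^sup>+\<omega>. f j \<omega> \<partial>M) \<le> ennreal (c j)" "\<And>j. 0 \<le> c j" "summable c" for f c
  proof -
    have "(\<Sum>j. \<integral>\<^sup>+\<omega>. f j \<omega> \<partial>M) \<le> (\<Sum>j. ennreal (c j))" using that(1) by (intro suminf_le) auto
    also have "\<dots> < \<infinity>" using that by (simp add: suminf_ennreal2)
    finally show ?thesis .
  qed
  have "AE \<omega> in M. (\<lambda>j. ennreal ((2^j * (X (n j) \<omega> - X (n (Suc j)) \<omega>))^4)) \<longlonglongrightarrow> 0"
  proof (intro AE_tendsto_zero_of_summable_integrals fin[where c = "\<lambda>j. (1/2)^j"])
    fix j
    have "((2::real)^j)^4 = (2^4)^j" by (simp only: power_mult[symmetric] mult.commute)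
    then have pow: "(2^j)^4 = (16::real)^j" by simp
    have "(\<integral>\<^sup>+\<omega>. ennreal ((2^j * (X (n j) \<omega> - X (n (Suc j)) \<omega>))^4) \<partial>M)
        = ennreal (16^j) * (\<integral>\<^sup>+\<omega>. ennreal ((X (n j) \<omega> - X (n (Suc j)) \<omega>)^4) \<partial>M)"
      by (subst nn_integral_cmult[symmetric])
        (auto simp: ennreal_mult'[symmetric] power_mult_distrib pow)
    also have "\<dots> \<le> ennreal (16^j) * ennreal ((1/32)^j)"
      by (intro mult_left_mono order_trans[OF mom[OF n_ge(2)]] ennreal_leI e_n) simp
    also have "\<dots> = ennreal ((1/2)^j)"
      by (simp add: ennreal_mult'[symmetric] power_mult_distrib[symmetric])
    finally show "(\<integral>\<^sup>+\<omega>. ennreal ((2^j * (X (n j) \<omega> - X (n (Suc j)) \<omega>))^4) \<partial>M) \<le> ennreal ((1/2)^j)" .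
  qed auto
  moreover have "AE \<omega> in M. (\<lambda>k. ennreal ((X k \<omega> - X (n k) \<omega>)^4)) \<longlonglongrightarrow> 0"
    using e mom[OF n_ge(1)]
    by (intro AE_tendsto_zero_of_summable_integrals fin[where c = e]) auto
  ultimately show ?thesis
  proof eventually_elim
    case (elim \<omega>)
    define x where "x j = X (n j) \<omega>" for j
    have "(\<lambda>j. 2^j * (x j - x (Suc j))) \<longlonglongrightarrow> 0"
      using tendsto_zero_of_fourth_power[OF elim(1)] by (simp add: x_def)
    then have "eventually (\<lambda>j. dist (2^j * (x j - x (Suc j))) 0 < 1) sequentially"
      by (rule tendstoD) simp
    then have "eventually (\<lambda>j. norm (x (Suc j) - x j) \<le> (1/2)^j) sequentially"
    proof eventually_elim
      case (elim j)
      then have "2^j * \<bar>x j - x (Suc j)\<bar> < 1" by (simp add: dist_real_def abs_mult del: right_diff_distrib)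
      then show ?case by (simp add: field_simps power_divide abs_minus_commute)
    qed
    then have "summable (\<lambda>j. x (Suc j) - x j)"
      by (rule summable_comparison_test_ev) simp
    then have "(\<lambda>J. (\<Sum>j<J. x (Suc j) - x j) + x 0) \<longlonglongrightarrow> (\<Sum>j. x (Suc j) - x j) + x 0"
      by (intro tendsto_add summable_LIMSEQ tendsto_const)
    then have "x \<longlonglongrightarrow> (\<Sum>j. x (Suc j) - x j) + x 0"
      by (simp add: sum_lessThan_telescope)
    then have "(\<lambda>k. (X k \<omega> - X (n k) \<omega>) + x k) \<longlonglongrightarrow> 0 + ((\<Sum>j. x (Suc j) - x j) + x 0)"
      by (intro tendsto_add tendsto_zero_of_fourth_power[OF elim(2)])
    then show ?case by (auto simp: x_def convergent_def)
  qed
qed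

text \<open>Every dyadic point of level \<open>m\<close> is joined to \<open>a\<close> by at most one increment of each level up to \<open>m\<close>, which
gives a geometric series; the remaining points are reached by continuity.\<close>
lemma dyadic_chaining:
  fixes w :: "real \<Rightarrow> real"
  assumes a: "0 < a" and cont: "continuous_on {a..2*a} w" and r: "0 \<le> r" "r < 1"
    and incr: "\<And>m j. j < 2^m \<Longrightarrow>
      \<bar>w (a + a * real (Suc j) / 2^m) - w (a + a * real j / 2^m)\<bar> \<le> c * r^m"
    and t: "t \<in> {a..2*a}"
  shows "\<bar>w t - w a\<bar> \<le> c / (1 - r)"
proof -
  define x where "x m j = a + a * real j / 2^m" for m j :: nat
  have d: "\<bar>w (x m (Suc j)) - w (x m j)\<bar> \<le> c * r^m" if "j < 2^m" for m j
    using incr[OF that] by (simp add: x_def)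
  have c0: "0 \<le> c" using incr[of 0 0] by simp
  have grid: "\<bar>w (x m j) - w a\<bar> \<le> c * (\<Sum>i\<le>m. r^i)" if "j \<le> 2^m" for m j
    using that
  proof (induction m arbitrary: j)
    case 0
    then have "j = 0 \<or> j = 1" by auto
    then show ?case using d[of 0 0] c0 by (auto simp: x_def)
  next
    case (Suc m)
    define i where "i = j div 2"
    have half: "x (Suc m) (2 * i) = x m i" by (simp add: x_def field_simps)
    have "i \<le> 2^m" using Suc.prems by (simp add: i_def)
    then have IH: "\<bar>w (x (Suc m) (2 * i)) - w a\<bar> \<le> c * (\<Sum>i\<le>m. r^i)"
      using Suc.IH half by simp
    have "j = 2 * i \<or> j = Suc (2 * i)" unfolding i_def by presburger
    then have "\<bar>w (x (Suc m) j) - w (x (Suc m) (2 * i))\<bar> \<le> c * r^Suc m"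
    proof
      assume "j = Suc (2 * i)"
      then show ?thesis using d[of "2 * i" "Suc m"] Suc.prems by (simp del: power_Suc)
    qed (use c0 r in simp)
    with IH have "\<bar>w (x (Suc m) j) - w a\<bar> \<le> c * (\<Sum>i\<le>m. r^i) + c * r^Suc m" by linarith
    then show ?case by (simp add: distrib_left)
  qed
  have geo: "(\<Sum>i\<le>m. r^i) \<le> 1 / (1 - r)" for m
    using sum_le_suminf[of "\<lambda>i. r^i" "{..m}"] r by (simp add: suminf_geometric)
  define y where "y = (t - a) / a"
  have y: "0 \<le> y" "y \<le> 1" and ty: "t = a + a * y" using t a by (auto simp: y_def field_simps)
  \<comment> \<open>the largest dyadic point of level \<open>m\<close> that does not exceed \<open>t\<close> has index \<open>j m\<close>\<close>
  define j where "j m = nat \<lfloor>y * 2^m\<rfloor>" for m :: nat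
  have j_le: "real (j m) \<le> y * 2^m" "y * 2^m - 1 \<le> real (j m)" for m
    using y by (auto simp: j_def)
  have j2: "j m \<le> 2^m" for m
  proof -
    have "y * 2^m \<le> 1 * 2^m" using y(2) by (intro mult_right_mono) auto
    then have "real (j m) \<le> 2^m" using j_le(1)[of m] by linarith
    then have "real (j m) \<le> real (2^m)" by simp
    then show ?thesis by (simp only: of_nat_le_iff)
  qed
  have "(\<lambda>m. real (j m) / 2^m) \<longlonglongrightarrow> y"
  proof (rule tendsto_sandwich)
    show "eventually (\<lambda>m. y - 1 / 2^m \<le> real (j m) / 2^m) sequentially"
    proof (intro always_eventually allI)
      fix m
      have "(y * 2^m - 1) / 2^m \<le> real (j m) / 2^m" using j_le(2) by (intro divide_right_mono) auto
      then show "y - 1 / 2^m \<le> real (j m) / 2^m" by (simp add: diff_divide_distrib)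
    qed
    show "eventually (\<lambda>m. real (j m) / 2^m \<le> y) sequentially"
      using j_le(1) by (simp add: field_simps)
    have "(\<lambda>m. y - 1 / 2^m) \<longlonglongrightarrow> y - 0"
      by (intro tendsto_diff tendsto_const LIMSEQ_divide_realpow_zero) simp
    then show "(\<lambda>m. y - 1 / 2^m) \<longlonglongrightarrow> y" by simp
  qed auto
  then have "(\<lambda>m. a + a * (real (j m) / 2^m)) \<longlonglongrightarrow> a + a * y"
    by (intro tendsto_add tendsto_mult tendsto_const)
  then have xt: "(\<lambda>m. x m (j m)) \<longlonglongrightarrow> t" by (simp add: x_def ty)
  have x_in: "x m (j m) \<in> {a..2*a}" for m
  proof -
    have "real (j m) \<le> real (2^m)" using j2[of m] by (simp only: of_nat_le_iff)
    then have "real (j m) / 2^m \<le> 1" by simp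
    then have "a * (real (j m) / 2^m) \<le> a * 1" using a by (intro mult_left_mono) auto
    then show ?thesis using a by (simp add: x_def)
  qed
  have "(\<lambda>m. w (x m (j m))) \<longlonglongrightarrow> w t"
    using continuous_on_tendsto_compose[OF cont xt t] x_in by simp
  then have "(\<lambda>m. \<bar>w (x m (j m)) - w a\<bar>) \<longlonglongrightarrow> \<bar>w t - w a\<bar>" by (intro tendsto_intros)
  moreover have "\<bar>w (x m (j m)) - w a\<bar> \<le> c / (1 - r)" for m
    using grid[OF j2, of m] mult_left_mono[OF geo c0, of m] by simp
  ultimately show ?thesis by (intro LIMSEQ_le_const2) auto
qed

text \<open>At level \<open>m\<close> there are \<open>2^m\<close> increments, each with fourth moment at most \<open>C * (1/4)^m\<close>. This leaves a factor \<open>(1/2)^m\<close>,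
part of which is spent on the weight \<open>(10/9)^(4 * m)\<close>: the weighted sum \<open>S\<close> of all fourth
powers still has finite expectation, and it controls every increment of level \<open>m\<close> by
\<open>root 4 S * (9/10)^m\<close>, as \<open>dyadic_chaining\<close> requires. The bound \<open>10 * root 4 S\<close> for the oscillation
accounts for the factor \<open>10000\<close> in the constant.\<close>
lemma chaining_fourth_moment:
  fixes W :: "real \<Rightarrow> 'a \<Rightarrow> real"
  assumes a: "0 < a" and C: "0 \<le> C"
    and meas: "\<And>t. t \<in> {a..2*a} \<Longrightarrow> W t \<in> borel_measurable M"
    and cont: "\<And>\<omega>. \<omega> \<in> space M \<Longrightarrow> continuous_on {a..2*a} (\<lambda>t. W t \<omega>)"
    and mom: "\<And>s t. a \<le> s \<Longrightarrow> s < t \<Longrightarrow> t \<le> 2*a \<Longrightarrow>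
      (\<integral>\<^sup>+\<omega>. ennreal ((W s \<omega> - W t \<omega>)^4) \<partial>M) \<le> ennreal (C * ((t - s) / a)\<^sup>2)"
  obtains Y where "Y \<in> borel_measurable M" "(\<integral>\<^sup>+\<omega>. Y \<omega> \<partial>M) \<le> ennreal (50000 * C)"
    "\<And>\<omega> t. \<omega> \<in> space M \<Longrightarrow> t \<in> {a..2*a} \<Longrightarrow> ennreal ((W t \<omega> - W a \<omega>)^4) \<le> Y \<omega>"
proof -
  define x where "x m j = a + a * real j / 2^m" for m j :: nat
  define d where "d m j \<omega> = (W (x m j) \<omega> - W (x m (Suc j)) \<omega>)^4" for m j \<omega>
  define S where "S \<omega> = (\<Sum>m. \<Sum>j<2^m. ennreal ((10/9)^(4*m) * d m j \<omega>))" for \<omega>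
  have d0: "0 \<le> d m j \<omega>" for m j \<omega> by (simp add: d_def)
  have x_in: "x m j \<in> {a..2*a}" if "j \<le> 2^m" for m j
  proof -
    have "real j \<le> real (2^m)" using that by (simp only: of_nat_le_iff)
    then have "real j / 2^m \<le> 1" by simp
    then have "a * (real j / 2^m) \<le> a * 1" using a by (intro mult_left_mono) auto
    then show ?thesis using a by (simp add: x_def)
  qed
  have [measurable]: "d m j \<in> borel_measurable M" if "j < 2^m" for m j
  proof -
    have "W (x m j) \<in> borel_measurable M" "W (x m (Suc j)) \<in> borel_measurable M"
      using that by (auto intro!: meas x_in)
    then show ?thesis unfolding d_def by measurable
  qed
  have level [measurable]: "(\<lambda>\<omega>. \<Sum>j<2^m. ennreal ((10/9)^(4*m) * d m j \<omega>)) \<in> borel_measurable M" for m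
    by (intro borel_measurable_sum) simp
  have Smeas: "S \<in> borel_measurable M" unfolding S_def by measurable
  have int_d: "(\<integral>\<^sup>+\<omega>. ennreal (d m j \<omega>) \<partial>M) \<le> ennreal (C * (1/4)^m)" if "j < 2^m" for m j
  proof -
    have xs: "x m (Suc j) - x m j = a / 2^m" by (simp add: x_def field_simps)
    then have "x m j < x m (Suc j)" using a by (metis diff_gt_0_iff_gt divide_pos_pos zero_less_numeral zero_less_power)
    then have "(\<integral>\<^sup>+\<omega>. ennreal (d m j \<omega>) \<partial>M) \<le> ennreal (C * ((x m (Suc j) - x m j) / a)\<^sup>2)"
      unfolding d_def using x_in[of j m] x_in[of "Suc j" m] that by (intro mom) auto
    also have "((x m (Suc j) - x m j) / a)\<^sup>2 = (1 / 2^m)\<^sup>2" unfolding xs using a by simp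
    also have "\<dots> = ((1/2)\<^sup>2)^m" by (simp only: power_mult[symmetric] mult.commute power_one_over)
    also have "(1/2::real)\<^sup>2 = 1/4" by (simp add: power2_eq_square)
    finally show ?thesis .
  qed
  have int_m: "(\<integral>\<^sup>+\<omega>. (\<Sum>j<2^m. ennreal ((10/9)^(4*m) * d m j \<omega>)) \<partial>M) \<le> ennreal (C * (5000/6561)^m)" for m
  proof -
    have "(\<integral>\<^sup>+\<omega>. (\<Sum>j<2^m. ennreal ((10/9)^(4*m) * d m j \<omega>)) \<partial>M)
        = (\<Sum>j<2^m. \<integral>\<^sup>+\<omega>. ennreal ((10/9)^(4*m)) * ennreal (d m j \<omega>) \<partial>M)"
      using d0 by (subst nn_integral_sum) (auto simp: ennreal_mult')
    also have "\<dots> = (\<Sum>j<2^m. ennreal ((10/9)^(4*m)) * (\<integral>\<^sup>+\<omega>. ennreal (d m j \<omega>) \<partial>M))"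
      by (intro sum.cong nn_integral_cmult) auto
    also have "\<dots> \<le> (\<Sum>j<(2::nat)^m. ennreal ((10/9)^(4*m)) * ennreal (C * (1/4)^m))"
      using int_d by (intro sum_mono mult_left_mono) auto
    also have "\<dots> = ennreal (2^m) * (ennreal ((10/9)^(4*m)) * ennreal (C * (1/4)^m))"
      by (simp add: ennreal_power[symmetric] ennreal_numeral)
    also have "\<dots> = ennreal (2^m * ((10/9)^(4*m) * (C * (1/4)^m)))"
      using C by (simp add: ennreal_mult)
    also have "2^m * ((10/9)^(4*m) * (C * (1/4)^m)) = C * (2 * (10/9)^4 * (1/4))^m"
      unfolding power_mult[of "10/9" 4 m] power_mult_distrib by (simp only: mult_ac)
    also have "2 * (10/9)^4 * (1/4) = (5000/6561::real)" by (simp add: power4_eq_xxxx)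
    finally show ?thesis .
  qed
  have int_S: "(\<integral>\<^sup>+\<omega>. S \<omega> \<partial>M) \<le> ennreal (5 * C)"
  proof -
    have "(\<integral>\<^sup>+\<omega>. S \<omega> \<partial>M) = (\<Sum>m. \<integral>\<^sup>+\<omega>. (\<Sum>j<2^m. ennreal ((10/9)^(4*m) * d m j \<omega>)) \<partial>M)"
      unfolding S_def by (rule nn_integral_suminf) measurable
    also have "\<dots> \<le> (\<Sum>m. ennreal (C * (5000/6561)^m))"
      using int_m by (intro suminf_le) auto
    also have "\<dots> = ennreal (\<Sum>m. C * (5000/6561)^m)"
      using C by (intro suminf_ennreal2 summable_mult summable_geometric) auto
    also have "(\<Sum>m. C * (5000/6561)^m) = C * (6561/1561)"
      by (subst suminf_mult) (auto simp: suminf_geometric)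
    also have "\<dots> \<le> 5 * C" using C by simp
    finally show ?thesis by (simp add: ennreal_leI)
  qed
  show thesis
  proof
    show "(\<lambda>\<omega>. ennreal 10000 * S \<omega>) \<in> borel_measurable M" using Smeas by measurable
    have "(\<integral>\<^sup>+\<omega>. ennreal 10000 * S \<omega> \<partial>M) \<le> ennreal 10000 * ennreal (5 * C)"
      using int_S Smeas by (subst nn_integral_cmult) (auto intro!: mult_left_mono)
    also have "\<dots> = ennreal (50000 * C)" by (subst ennreal_mult'[symmetric]) simp_all
    finally show "(\<integral>\<^sup>+\<omega>. ennreal 10000 * S \<omega> \<partial>M) \<le> ennreal (50000 * C)" .
  next
    fix \<omega> t assume \<omega>: "\<omega> \<in> space M" and t: "t \<in> {a..2*a}"
    show "ennreal ((W t \<omega> - W a \<omega>)^4) \<le> ennreal 10000 * S \<omega>"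
    proof (cases "S \<omega> = \<infinity>")
      case False
      then obtain \<sigma> where \<sigma>: "0 \<le> \<sigma>" "S \<omega> = ennreal \<sigma>" by (cases "S \<omega>") auto
      have incr: "\<bar>W (a + a * real (Suc j) / 2^m) \<omega> - W (a + a * real j / 2^m) \<omega>\<bar> \<le> root 4 \<sigma> * (9/10)^m"
        if j: "j < 2^m" for m j
      proof -
        let ?D = "\<bar>W (x m (Suc j)) \<omega> - W (x m j) \<omega>\<bar>"
        have "ennreal ((10/9)^(4*m) * d m j \<omega>) \<le> (\<Sum>j<2^m. ennreal ((10/9)^(4*m) * d m j \<omega>))"
          using j by (intro member_le_sum) auto
        also have "\<dots> \<le> S \<omega>"
          unfolding S_def using sum_le_suminf[OF summableI, of "{m}" "\<lambda>m. \<Sum>j<2^m. ennreal ((10/9)^(4*m) * d m j \<omega>)"]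
          by simp
        finally have "(10/9)^(4*m) * d m j \<omega> \<le> \<sigma>" using \<sigma> d0 by simp
        moreover have "d m j \<omega> = ?D^4" by (simp add: d_def power_even_abs power4_eq_xxxx algebra_simps)
        moreover have "(10/9::real)^(4*m) = ((10/9)^m)^4" by (simp only: power_mult[symmetric] mult.commute)
        ultimately have "((10/9)^m * ?D)^4 \<le> \<sigma>" by (simp add: power_mult_distrib)
        then have "root 4 (((10/9)^m * ?D)^4) \<le> root 4 \<sigma>" by simp
        then have "(10/9)^m * ?D \<le> root 4 \<sigma>" by (subst (asm) real_root_power_cancel) auto
        then have "(9/10)^m * ((10/9)^m * ?D) \<le> (9/10)^m * root 4 \<sigma>" by (intro mult_left_mono) auto
        moreover have "(9/10)^m * ((10/9)^m * ?D) = ?D"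
          by (simp add: mult.assoc[symmetric] power_mult_distrib[symmetric])
        ultimately have "?D \<le> root 4 \<sigma> * (9/10)^m" by (simp only: mult.commute)
        then show ?thesis unfolding x_def .
      qed
      have "\<bar>W t \<omega> - W a \<omega>\<bar> \<le> root 4 \<sigma> / (1 - 9/10)"
        by (rule dyadic_chaining[OF a cont[OF \<omega>] _ _ incr t]) auto
      then have "\<bar>W t \<omega> - W a \<omega>\<bar>^4 \<le> (10 * root 4 \<sigma>)^4" by (intro power_mono) auto
      also have "\<dots> = 10000 * \<sigma>" using \<sigma> by (simp add: power_mult_distrib)
      finally show ?thesis using \<sigma> by (simp add: ennreal_mult'[symmetric] power_even_abs ennreal_leI del: ennreal_numeral)
    qed (simp add: ennreal_mult_top)
  qed
qed

section \<open>Laplace transforms characterize gamma laws\<close>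

text \<open>For a law on the unit interval the moments are at most \<open>1\<close>, so the Taylor polynomials of the
characteristic function converge to it, and they only involve the moments.\<close>
lemma real_distribution_eq_of_moments:
  assumes M1: "real_distribution M1" and M2: "real_distribution M2"
    and supp: "AE x in M1. x \<in> {0..1}" "AE x in M2. x \<in> {0..1}"
    and mom: "\<And>k. (\<integral>x. x^k \<partial>M1) = (\<integral>x. x^k \<partial>M2)"
  shows "M1 = M2"
proof (rule Levy_uniqueness[OF M1 M2])
  have approx: "(\<lambda>n. \<Sum>k\<le>n. ((\<i> * t)^k / fact k) * (\<integral>x. x^k \<partial>M)) \<longlonglongrightarrow> char M t"
    if "real_distribution M" and ae: "AE x in M. x \<in> {0..1}" for M t
  proof -
    interpret real_distribution M by fact
    have int: "integrable M (\<lambda>x. x^k)" for k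
    proof (rule integrable_const_bound[of _ 1])
      show "AE x in M. norm (x^k) \<le> 1" using ae by eventually_elim (simp add: power_le_one)
    qed simp
    have abs_mom: "(\<integral>x. \<bar>x\<bar>^k \<partial>M) \<le> 1" for k
    proof -
      have "(\<integral>x. \<bar>x\<bar>^k \<partial>M) \<le> (\<integral>x. 1 \<partial>M)"
      proof (rule integral_mono_AE)
        show "integrable M (\<lambda>x. \<bar>x\<bar>^k)" using integrable_abs[OF int[of k]] by (simp add: power_abs)
        show "AE x in M. \<bar>x\<bar>^k \<le> 1" using ae by eventually_elim (simp add: power_le_one)
      qed simp
      then show ?thesis using prob_space by simp
    qed
    have err: "norm (char M t - (\<Sum>k\<le>n. ((\<i> * t)^k / fact k) * (\<integral>x. x^k \<partial>M))) \<le> 2 * (\<bar>t\<bar>^n / fact n)" for n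
    proof -
      have "norm (char M t - (\<Sum>k\<le>n. ((\<i> * t)^k / fact k) * (\<integral>x. x^k \<partial>M)))
          \<le> (2 * \<bar>t\<bar>^n / fact n) * (\<integral>x. \<bar>x\<bar>^n \<partial>M)"
        by (rule char_approx1) (rule int)
      also have "\<dots> \<le> (2 * \<bar>t\<bar>^n / fact n) * 1" by (intro mult_left_mono abs_mom) auto
      finally show ?thesis by simp
    qed
    have "(\<lambda>n. 2 * (\<bar>t\<bar>^n / fact n)) \<longlonglongrightarrow> 0"
    proof -
      have "(\<lambda>n. inverse (fact n) * \<bar>t\<bar>^n) \<longlonglongrightarrow> 0"
        by (rule summable_LIMSEQ_zero) (rule summable_exp)
      then have "(\<lambda>n. 2 * (inverse (fact n) * \<bar>t\<bar>^n)) \<longlonglongrightarrow> 0" by (rule tendsto_mult_right_zero)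
      then show ?thesis by (simp only: divide_inverse mult_ac)
    qed
    from Lim_null_comparison[OF always_eventually[OF allI[OF err]] this]
    have "(\<lambda>n. char M t - (\<Sum>k\<le>n. ((\<i> * t)^k / fact k) * (\<integral>x. x^k \<partial>M))) \<longlonglongrightarrow> 0" .
    then have "(\<lambda>n. char M t - (char M t - (\<Sum>k\<le>n. ((\<i> * t)^k / fact k) * (\<integral>x. x^k \<partial>M)))) \<longlonglongrightarrow> char M t - 0"
      by (intro tendsto_diff tendsto_const)
    then show ?thesis by simp
  qed
  show "char M1 = char M2"
  proof
    fix t
    show "char M1 t = char M2 t"
      by (rule LIMSEQ_unique[OF approx[OF M1 supp(1)] approx[OF M2 supp(2), folded mom]])
  qed
qed

lemma gamma_density_measurable [measurable]: "gamma_density \<alpha> \<in> borel_measurable borel"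
  unfolding gamma_density_def by measurable

text \<open>The substitution \<open>y = (1 + l) * x\<close> turns the integral into Euler's integral for \<open>Gamma \<alpha>\<close>.\<close>
lemma nn_integral_gamma_laplace:
  assumes \<alpha>: "0 < \<alpha>" and l: "0 \<le> l"
  shows "(\<integral>\<^sup>+x. ennreal (exp (- l * x)) * ennreal (gamma_density \<alpha> x) \<partial>lborel) = ennreal ((1 + l) powr (-\<alpha>))"
proof -
  let ?g = "\<lambda>y::real. ennreal (indicator {0..} y * y powr (\<alpha> - 1) / exp y)"
  define c where "c = 1 + l"
  have c: "0 < c" using l by (simp add: c_def)
  have G: "0 < Gamma \<alpha>" using \<alpha> by (rule Gamma_real_pos)
  \<comment> \<open>the two sides may differ at \<open>0\<close>, where \<open>gamma_density\<close> is set to \<open>0\<close>\<close>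
  have eq: "ennreal (exp (- l * x)) * ennreal (gamma_density \<alpha> x)
      = ennreal (c powr (1 - \<alpha>) / Gamma \<alpha>) * ?g (0 + c * x)" if "x \<noteq> 0" for x
  proof (cases "0 < x")
    case True
    have "(c * x) powr (\<alpha> - 1) = c powr (\<alpha> - 1) * x powr (\<alpha> - 1)" using c True by (simp add: powr_mult)
    moreover have "c powr (1 - \<alpha>) * c powr (\<alpha> - 1) = 1" using c by (simp add: powr_add[symmetric])
    moreover have "exp (- (c * x)) = exp (- (l * x)) * exp (- x)" by (simp add: c_def exp_add[symmetric] algebra_simps)
    ultimately have "exp (- l * x) * gamma_density \<alpha> x
        = c powr (1 - \<alpha>) / Gamma \<alpha> * ((c * x) powr (\<alpha> - 1) / exp (c * x))"
      using True G by (simp add: gamma_density_def exp_minus_inverse divide_inverse exp_minus[symmetric])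
    then show ?thesis using True c G by (simp add: ennreal_mult'[symmetric])
  next
    case False
    then have "c * x < 0" using c that by (intro mult_pos_neg) auto
    then show ?thesis using False by (simp add: gamma_density_def)
  qed
  have "(\<integral>\<^sup>+x. ennreal (exp (- l * x)) * ennreal (gamma_density \<alpha> x) \<partial>lborel)
      = (\<integral>\<^sup>+x. ennreal (c powr (1 - \<alpha>) / Gamma \<alpha>) * ?g (0 + c * x) \<partial>lborel)"
  proof (rule nn_integral_cong_AE)
    show "AE x in lborel. ennreal (exp (- l * x)) * ennreal (gamma_density \<alpha> x)
        = ennreal (c powr (1 - \<alpha>) / Gamma \<alpha>) * ?g (0 + c * x)"
      using AE_lborel_singleton[of "0::real"] by eventually_elim (rule eq)
  qed
  also have "\<dots> = ennreal (c powr (1 - \<alpha>) / Gamma \<alpha>) * (\<integral>\<^sup>+x. ?g (0 + c * x) \<partial>lborel)"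
    by (intro nn_integral_cmult) measurable
  also have "(\<integral>\<^sup>+x. ?g (0 + c * x) \<partial>lborel) = ennreal (1 / c) * (\<integral>\<^sup>+x. ?g x \<partial>lborel)"
    using c by (subst nn_integral_real_affine[of ?g c 0])
      (auto simp: mult.assoc[symmetric] ennreal_mult'[symmetric])
  also have "(\<integral>\<^sup>+x. ?g x \<partial>lborel) = ennreal (Gamma \<alpha>)"
    using Gamma_conv_nn_integral_real[OF \<alpha>] by simp
  also have "ennreal (c powr (1 - \<alpha>) / Gamma \<alpha>) * (ennreal (1 / c) * ennreal (Gamma \<alpha>))
      = ennreal (c powr (1 - \<alpha>) / c)"
    using G c by (simp add: ennreal_mult'[symmetric])
  also have "c powr (1 - \<alpha>) / c = c powr (-\<alpha>)"
    using c by (simp add: powr_diff powr_minus divide_inverse)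
  finally show ?thesis by (simp add: c_def)
qed

text \<open>The values of the Laplace transform at the natural numbers are the moments of \<open>exp (- \<xi>)\<close>, which lies in the unit
interval, so its law is the one obtained from a gamma variable; the logarithm recovers \<open>\<xi>\<close>.\<close>
lemma (in prob_space) distributed_gamma_of_laplace:
  fixes \<xi> :: "'a \<Rightarrow> real"
  assumes \<alpha>: "0 < \<alpha>" and \<xi>[measurable]: "\<xi> \<in> borel_measurable M" and nonneg: "AE \<omega> in M. 0 \<le> \<xi> \<omega>"
    and lap: "\<And>k. (\<integral>\<omega>. exp (- (real k * \<xi> \<omega>)) \<partial>M) = (1 + real k) powr (-\<alpha>)"
  shows "distributed M lborel \<xi> (\<lambda>x. ennreal (gamma_density \<alpha> x))"
proof -
  define D where "D = density lborel (\<lambda>x. ennreal (gamma_density \<alpha> x))"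
  have [measurable_cong]: "sets D = sets borel" by (simp add: D_def)
  have lapD: "(\<integral>\<^sup>+x. ennreal (exp (- l * x)) \<partial>D) = ennreal ((1 + l) powr (-\<alpha>))" if "0 \<le> l" for l
    unfolding D_def using nn_integral_gamma_laplace[OF \<alpha> that]
    by (subst nn_integral_density) (auto simp: mult.commute)
  interpret D: prob_space D
    using lapD[of 0] by (intro prob_spaceI) (simp add: nn_integral_const)
  define \<mu> where "\<mu> = distr M borel (\<lambda>\<omega>. exp (- \<xi> \<omega>))"
  define \<nu> where "\<nu> = distr D borel (\<lambda>x. exp (- x))"
  have "\<mu> = \<nu>"
  proof (rule real_distribution_eq_of_moments)
    show "real_distribution \<mu>" unfolding \<mu>_def by (intro real_distribution_distr) simp
    show "real_distribution \<nu>" unfolding \<nu>_def by (intro D.real_distribution_distr) simp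
    show "AE x in \<mu>. x \<in> {0..1}"
      unfolding \<mu>_def using nonneg by (subst AE_distr_iff) (auto elim!: eventually_mono)
    have "AE x in D. 0 \<le> x"
      unfolding D_def by (subst AE_density) (auto simp: gamma_density_def split: if_splits)
    then show "AE x in \<nu>. x \<in> {0..1}"
      unfolding \<nu>_def by (subst AE_distr_iff) (auto elim!: eventually_mono)
    fix k
    have "(\<integral>x. x^k \<partial>\<mu>) = (\<integral>\<omega>. exp (- (real k * \<xi> \<omega>)) \<partial>M)"
      unfolding \<mu>_def by (subst integral_distr) (auto simp: exp_of_nat_mult[symmetric])
    also have "\<dots> = (1 + real k) powr (-\<alpha>)" by (rule lap)
    also have "\<dots> = (\<integral>x. exp (- real k * x) \<partial>D)"
      using lapD[of "real k"] by (subst integral_eq_nn_integral) auto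
    also have "\<dots> = (\<integral>x. x^k \<partial>\<nu>)"
      unfolding \<nu>_def by (subst integral_distr) (auto simp: exp_of_nat_mult[symmetric])
    finally show "(\<integral>x. x^k \<partial>\<mu>) = (\<integral>x. x^k \<partial>\<nu>)" .
  qed
  then have "distr \<mu> borel (\<lambda>y. - ln y) = distr \<nu> borel (\<lambda>y. - ln y)" by simp
  then have "distr M borel \<xi> = distr D borel (\<lambda>x. x)"
    unfolding \<mu>_def \<nu>_def by (subst (asm) (1 2) distr_distr) (auto simp: comp_def)
  also have "\<dots> = D" by (rule distr_id2) (simp add: D_def)
  finally have "distr M borel \<xi> = D" .
  moreover have "distr M lborel \<xi> = distr M borel \<xi>" by (rule distr_cong) auto
  ultimately show ?thesis
    unfolding distributed_def D_def by (auto intro!: measurable_compose[OF gamma_density_measurable])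
qed

section \<open>Realizing the limit on path space\<close>

text \<open>The new space consists of the pairs (path, limit) that occur for good outcomes, with the trace of the product
\<open>\<sigma>\<close>-algebra. Restricting to these pairs makes every path continuous. The set of paths with the desired limit need not be
measurable in the product \<open>\<sigma>\<close>-algebra, so an almost sure statement would not simply carry over to the image measure; therefore all outcomes in a
null set \<open>N0\<close> that contains the bad ones are first redirected to one good outcome \<open>\<omega>0\<close>. This changes no law, and
afterwards the limit holds at every point of the new space.\<close>
lemma coupling_of_AE_limit:
  fixes f :: "real \<Rightarrow> real" and M :: "'a measure" and Z :: "real \<Rightarrow> 'a \<Rightarrow> real"
  assumes perm: "permanental_process M \<alpha> {0<..} u Z" and cont: "continuous_paths M {0<..} Z"
    and dist: "distributed M lborel \<xi> g"
    and lim: "AE \<omega> in M. ((\<lambda>t. Z t \<omega> / f t) \<longlongrightarrow> \<xi> \<omega>) (at_right 0)"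
  shows "\<exists>(N :: ((real \<Rightarrow> real) \<times> real) measure) (Z' :: real \<Rightarrow> (real \<Rightarrow> real) \<times> real \<Rightarrow> real)
            (\<xi>' :: (real \<Rightarrow> real) \<times> real \<Rightarrow> real).
           prob_space N \<and> permanental_process N \<alpha> {0<..} u Z' \<and> continuous_paths N {0<..} Z' \<and>
           process_law N {0<..} Z' = process_law M {0<..} Z \<and> distributed N lborel \<xi>' g \<and>
           (AE \<omega> in N. ((\<lambda>t. Z' t \<omega> / f t) \<longlongrightarrow> \<xi>' \<omega>) (at_right 0))"
proof -
  interpret prob_space M by (rule permanental_process_prob_space[OF perm])
  have Zm [measurable]: "Z t \<in> borel_measurable M" if "0 < t" for t
    using permanental_process_measurable(1)[OF perm] that by simp
  have \<xi>m: "\<xi> \<in> measurable M lborel" using dist by (simp add: distributed_def)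
  then have [measurable]: "\<xi> \<in> borel_measurable M" by simp
  obtain N0 where N0: "{\<omega>\<in>space M. \<not> ((\<lambda>t. Z t \<omega> / f t) \<longlongrightarrow> \<xi> \<omega>) (at_right 0)} \<subseteq> N0"
    "emeasure M N0 = 0" and [measurable]: "N0 \<in> sets M"
    using lim by (elim AE_E)
  have "space M - N0 \<noteq> {}"
  proof
    assume "space M - N0 = {}"
    then have "emeasure M (space M) \<le> emeasure M N0" by (intro emeasure_mono) auto
    then show False using N0 emeasure_space_1 by simp
  qed
  then obtain \<omega>0 where \<omega>0: "\<omega>0 \<in> space M" "\<omega>0 \<notin> N0" by blast
  define c where "c \<omega> = (if \<omega> \<in> N0 then \<omega>0 else \<omega>)" for \<omega>
  have c [measurable]: "c \<in> measurable M M" unfolding c_def using \<omega>0 by measurable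
  have c_good: "c \<omega> \<in> space M - N0" if "\<omega> \<in> space M" for \<omega> using that \<omega>0 by (simp add: c_def)
  have c_AE: "AE \<omega> in M. c \<omega> = \<omega>"
    using N0 by (intro AE_I[of _ _ N0]) (auto simp: c_def)
  define P where "P = (\<Pi>\<^sub>M t\<in>{(0::real)<..}. (borel :: real measure)) \<Otimes>\<^sub>M (borel :: real measure)"
  define \<Phi> where "\<Phi> \<omega> = (\<lambda>t\<in>{0<..}. Z t \<omega>, \<xi> \<omega>)" for \<omega>
  define N' where "N' = restrict_space P (\<Phi> ` (space M - N0))"
  define N where "N = distr M N' (\<lambda>\<omega>. \<Phi> (c \<omega>))"
  define Z' where "Z' t x = fst x t" for t and x :: "(real \<Rightarrow> real) \<times> real"
  have path [measurable]: "(\<lambda>\<omega>. \<lambda>t\<in>{0<..}. Z t \<omega>) \<in> measurable M (\<Pi>\<^sub>M t\<in>{0<..}. borel)"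
    by (intro measurable_restrict) simp
  have "\<Phi> \<in> measurable M P" unfolding \<Phi>_def P_def by measurable
  then have \<Phi>c [measurable]: "(\<lambda>\<omega>. \<Phi> (c \<omega>)) \<in> measurable M N'"
    unfolding N'_def using c_good by (intro measurable_restrict_space2 measurable_compose[OF c]) auto
  have N_good: "\<exists>\<omega>\<in>space M - N0. x = \<Phi> \<omega>" if "x \<in> space N" for x
    using that by (auto simp: N_def N'_def space_restrict_space)
  have Z'_\<Phi>: "Z' t (\<Phi> \<omega>) = Z t \<omega>" if "0 < t" for t \<omega> using that by (simp add: Z'_def \<Phi>_def)
  have setsN [measurable_cong]: "sets N = sets N'" by (simp add: N_def)
  have fstP: "fst \<in> measurable N' (\<Pi>\<^sub>M t\<in>{(0::real)<..}. (borel :: real measure))"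
    unfolding N'_def P_def by (intro measurable_restrict_space1 measurable_fst)
  have Z'm [measurable]: "Z' t \<in> borel_measurable N'" if "0 < t" for t
    unfolding Z'_def using that
    by (intro measurable_compose[OF fstP measurable_component_singleton]) simp
  have sndP [measurable]: "snd \<in> borel_measurable N'"
    unfolding N'_def P_def by (intro measurable_restrict_space1 measurable_snd)
  have "prob_space N" unfolding N_def by (rule prob_space_distr) simp
  moreover have "permanental_process N \<alpha> {0<..} u Z'"
    unfolding permanental_process_def permanental_vector_def
  proof (intro allI impI conjI ballI)
    fix n and t :: "nat \<Rightarrow> real" assume t: "\<forall>i<n. t i \<in> {0<..}"
    show "prob_space N" by fact
    show "Matrix.mat n n (\<lambda>(i, j). u (t i) (t j)) \<in> carrier_mat n n" by simp
    fix i assume "i < n"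
    then have "0 < t i" using t by simp
    then show "Z' (t i) \<in> borel_measurable N" by measurable
    fix x assume "x \<in> space N"
    then show "0 \<le> Z' (t i) x"
      using N_good[of x] Z'_\<Phi>[OF \<open>0 < t i\<close>] permanental_process_measurable(2)[OF perm, of "t i"] \<open>0 < t i\<close>
      by auto
  next
    fix n and t s :: "nat \<Rightarrow> real" assume t: "\<forall>i<n. t i \<in> {0<..}" and s: "\<forall>i<n. 0 < s i"
    have [measurable]: "Z' (t i) \<in> borel_measurable N'" "Z (t i) \<in> borel_measurable M" if "i < n" for i
      using t that by auto
    have "(\<integral>x. exp (- (\<Sum>i<n. s i * Z' (t i) x)) \<partial>N) = (\<integral>\<omega>. exp (- (\<Sum>i<n. s i * Z' (t i) (\<Phi> (c \<omega>)))) \<partial>M)"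
      unfolding N_def by (rule integral_distr) measurable
    also have "\<dots> = (\<integral>\<omega>. exp (- (\<Sum>i<n. s i * Z (t i) (c \<omega>))) \<partial>M)"
      using t by (intro Bochner_Integration.integral_cong refl arg_cong[of _ _ "\<lambda>x. exp (- x)"] sum.cong) (auto simp: Z'_\<Phi>)
    also have "\<dots> = (\<integral>\<omega>. exp (- (\<Sum>i<n. s i * Z (t i) \<omega>)) \<partial>M)"
    proof (rule integral_cong_AE)
      have h: "(\<lambda>\<omega>. exp (- (\<Sum>i<n. s i * Z (t i) \<omega>))) \<in> borel_measurable M" by measurable
      then show "(\<lambda>\<omega>. exp (- (\<Sum>i<n. s i * Z (t i) (c \<omega>)))) \<in> borel_measurable M"
        by (rule measurable_compose[OF c])
      show "(\<lambda>\<omega>. exp (- (\<Sum>i<n. s i * Z (t i) \<omega>))) \<in> borel_measurable M" by (rule h)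
      show "AE \<omega> in M. exp (- (\<Sum>i<n. s i * Z (t i) (c \<omega>))) = exp (- (\<Sum>i<n. s i * Z (t i) \<omega>))"
        using c_AE by eventually_elim simp
    qed
    also have "\<dots> = Determinant.det (1\<^sub>m n + Matrix.mat n n (\<lambda>(i, j). u (t i) (t j)) * mat_diag n s) powr - \<alpha>"
      using perm t s unfolding permanental_process_def permanental_vector_def by blast
    finally show "(\<integral>x. exp (- (\<Sum>i<n. s i * Z' (t i) x)) \<partial>N)
      = Determinant.det (1\<^sub>m n + Matrix.mat n n (\<lambda>(i, j). u (t i) (t j)) * mat_diag n s) powr - \<alpha>" .
  qed
  moreover have "continuous_paths N {0<..} Z'"
    unfolding continuous_paths_def
  proof
    fix x assume "x \<in> space N"
    then obtain \<omega> where \<omega>: "\<omega> \<in> space M" "x = \<Phi> \<omega>" using N_good by blast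
    have "continuous_on {0<..} (\<lambda>t. Z' t x) \<longleftrightarrow> continuous_on {0<..} (\<lambda>t. Z t \<omega>)"
      by (intro continuous_on_cong) (auto simp: \<omega> Z'_\<Phi>)
    then show "continuous_on {0<..} (\<lambda>t. Z' t x)" using cont \<omega> by (simp add: continuous_paths_def)
  qed
  moreover have "process_law N {0<..} Z' = process_law M {0<..} Z"
  proof -
    have "process_law N {0<..} Z' = distr M (\<Pi>\<^sub>M t\<in>{0<..}. borel) (\<lambda>\<omega>. \<lambda>t\<in>{0<..}. Z' t (\<Phi> (c \<omega>)))"
      unfolding process_law_def N_def
      by (subst distr_distr) (auto simp: comp_def intro!: measurable_restrict)
    also have "\<dots> = process_law M {0<..} Z"
      unfolding process_law_def
    proof (rule distr_cong_AE)
      have "(\<lambda>\<omega>. \<lambda>t\<in>{0<..}. Z' t (\<Phi> (c \<omega>))) = (\<lambda>\<omega>. \<lambda>t\<in>{0<..}. Z t (c \<omega>))"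
        by (auto simp: Z'_\<Phi> fun_eq_iff restrict_def)
      then show "(\<lambda>\<omega>. \<lambda>t\<in>{0<..}. Z' t (\<Phi> (c \<omega>))) \<in> measurable M (\<Pi>\<^sub>M t\<in>{0<..}. borel)"
        using measurable_compose[OF c path] by simp
      show "AE \<omega> in M. (\<lambda>t\<in>{0<..}. Z' t (\<Phi> (c \<omega>))) = (\<lambda>t\<in>{0<..}. Z t \<omega>)"
        using c_AE by eventually_elim (auto simp: Z'_\<Phi> fun_eq_iff restrict_def)
    qed (auto simp: path)
    finally show ?thesis .
  qed
  moreover have "distributed N lborel snd g"
  proof -
    have "distr N lborel snd = distr M lborel (\<lambda>\<omega>. snd (\<Phi> (c \<omega>)))"
      unfolding N_def by (subst distr_distr) (auto simp: comp_def)
    also have "\<dots> = distr M lborel (\<lambda>\<omega>. \<xi> (c \<omega>))" by (simp add: \<Phi>_def)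
    also have "\<dots> = distr M lborel \<xi>"
      using c_AE by (intro distr_cong_AE) (auto elim!: eventually_mono)
    finally show ?thesis using dist sndP setsN by (auto simp: distributed_def)
  qed
  moreover have "AE x in N. ((\<lambda>t. Z' t x / f t) \<longlongrightarrow> snd x) (at_right 0)"
  proof (rule AE_I2)
    fix x assume "x \<in> space N"
    then obtain \<omega> where \<omega>: "\<omega> \<in> space M" "\<omega> \<notin> N0" "x = \<Phi> \<omega>" using N_good by blast
    have "eventually (\<lambda>t. Z t \<omega> / f t = Z' t x / f t) (at_right 0)"
      by (auto simp: eventually_at_right_field \<omega> Z'_\<Phi> intro: exI[of _ 1])
    moreover have "((\<lambda>t. Z t \<omega> / f t) \<longlongrightarrow> snd x) (at_right 0)"
      using N0(1) \<omega> by (auto simp: \<Phi>_def)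
    ultimately show "((\<lambda>t. Z' t x / f t) \<longlongrightarrow> snd x) (at_right 0)"
      by (rule Lim_transform_eventually[rotated])
  qed
  ultimately show ?thesis by blast
qed

section \<open>The normalized permanental process\<close>

lemma u_tilde_laplace_one:
  assumes perm: "permanental_process M \<alpha> {0<..} (u_tilde f) Z"
    and t: "0 < t" "0 < f t" and a: "0 < a"
  shows "(\<integral>\<omega>. exp (- (a * (Z t \<omega> / (t + f t)))) \<partial>M) = (1 + a) powr (-\<alpha>)"
  using permanental_process_laplace_one[OF perm, of t "a / (t + f t)"] t a
  by (simp add: u_tilde_def add_pos_pos)

text \<open>For \<open>s < t\<close> the minimum in the kernel gives \<open>u (s, t) = s + f t = G t - (t - s)\<close> and \<open>u (t, s) = G s\<close>, where
\<open>G t = t + f t\<close>. After normalization the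
product of the off-diagonal entries is \<open>1 - h\<close> with \<open>h = (t - s) / G t\<close>, which leaves the coefficient \<open>h\<close> of \<open>a * b\<close>.\<close>
lemma u_tilde_laplace_two:
  assumes perm: "permanental_process M \<alpha> {0<..} (u_tilde f) Z"
    and st: "0 < s" "s < t" and f: "0 < f s" "0 < f t" and ab: "0 < a" "0 < b"
  shows "(\<integral>\<omega>. exp (- (a * (Z s \<omega> / (s + f s)) + b * (Z t \<omega> / (t + f t)))) \<partial>M)
    = (1 + a + b + (t - s) / (t + f t) * a * b) powr (-\<alpha>)"
proof -
  define S T where "S = s + f s" and "T = t + f t"
  have ST: "0 < S" "0 < T" using st f by (auto simp: S_def T_def)
  have u: "u_tilde f s s = S" "u_tilde f t t = T" "u_tilde f s t = T - (t - s)" "u_tilde f t s = S"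
    using st by (auto simp: u_tilde_def S_def T_def)
  have "(\<integral>\<omega>. exp (- (a / S * Z s \<omega> + b / T * Z t \<omega>)) \<partial>M)
      = ((1 + a / S * S) * (1 + b / T * T) - a / S * (b / T) * (T - (t - s)) * S) powr (-\<alpha>)"
    using permanental_process_laplace_two[OF perm, of s t "a / S" "b / T"] st ab ST
    unfolding u by simp
  also have "(1 + a / S * S) * (1 + b / T * T) - a / S * (b / T) * (T - (t - s)) * S
      = 1 + a + b + (t - s) / T * a * b"
    using ST by (simp add: field_simps)
  finally show ?thesis by (simp add: S_def T_def)
qed

lemma u_tilde_fourth_moment:
  assumes \<alpha>: "0 < \<alpha>" and perm: "permanental_process M \<alpha> {0<..} (u_tilde f) Z"
    and st: "0 < s" "s < t" and f: "0 < f s" "0 < f t"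
  shows "(\<integral>\<^sup>+\<omega>. ennreal ((Z s \<omega> / (s + f s) - Z t \<omega> / (t + f t))^4) \<partial>M)
    \<le> ennreal (16 * \<alpha> * (\<alpha> + 1) * ((t - s) / (t + f t))\<^sup>2)"
proof -
  interpret prob_space M by (rule permanental_process_prob_space[OF perm])
  have [measurable]: "Z s \<in> borel_measurable M" "Z t \<in> borel_measurable M"
    using permanental_process_measurable(1)[OF perm] st by auto
  show ?thesis
  proof (rule fourth_moment_of_laplace[OF _ _ _ _ \<alpha>])
    show "0 \<le> Z s \<omega> / (s + f s)" "0 \<le> Z t \<omega> / (t + f t)" if "\<omega> \<in> space M" for \<omega>
      using permanental_process_measurable(2)[OF perm _ that] st f by auto
    show "0 \<le> (t - s) / (t + f t)" using st f by simp
  qed (use u_tilde_laplace_two[OF perm st f] in simp_all)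
qed

lemma dyadic_block:
  fixes t :: real
  assumes "0 < t" "t < (1/2)^n"
  obtains k where "n \<le> k" "(1/2)^Suc k \<le> t" "t \<le> 2 * (1/2)^Suc k"
proof -
  obtain j0 where "(1/2::real)^j0 \<le> t"
    using real_arch_pow_inv[OF assms(1), of "1/2"] by (auto intro: less_imp_le)
  define j where "j = (LEAST j. (1/2::real)^j \<le> t)"
  have j: "(1/2)^j \<le> t" unfolding j_def by (rule LeastI) fact
  have below: "t < (1/2)^i" if "i < j" for i
    using not_less_Least[of i "\<lambda>j. (1/2::real)^j \<le> t"] that by (simp add: j_def not_le)
  have "n < j"
  proof (rule ccontr)
    assume "\<not> n < j"
    then have "(1/2::real)^n \<le> (1/2)^j" by (intro power_decreasing) auto
    also note j
    also note assms(2)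
    finally show False by simp
  qed
  then obtain k where k: "j = Suc k" "n \<le> k" by (cases j) auto
  show thesis using that[OF k(2)] j below[of k] unfolding k by simp
qed

lemma limit_along_dyadic_blocks:
  fixes w :: "real \<Rightarrow> real" and y :: "nat \<Rightarrow> ennreal"
  assumes lim: "(\<lambda>k. w ((1/2)^k)) \<longlonglongrightarrow> l" and y: "y \<longlonglongrightarrow> 0"
    and osc: "\<And>k t. (1/2)^Suc k \<le> t \<Longrightarrow> t \<le> 2 * (1/2)^Suc k \<Longrightarrow>
      ennreal ((w t - w ((1/2)^Suc k))^4) \<le> y k"
  shows "(w \<longlongrightarrow> l) (at_right 0)"
proof (rule tendstoI)
  fix \<epsilon> :: real assume \<epsilon>: "0 < \<epsilon>"
  have "eventually (\<lambda>k. dist (w ((1/2)^k)) l < \<epsilon>/2) sequentially"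
    using \<epsilon> by (intro tendstoD[OF lim]) simp
  moreover have "eventually (\<lambda>k. y k < ennreal ((\<epsilon>/2)^4)) sequentially"
    using order_tendstoD(2)[OF y] \<epsilon> by simp
  ultimately have "eventually (\<lambda>k. dist (w ((1/2)^k)) l < \<epsilon>/2 \<and> y k < ennreal ((\<epsilon>/2)^4)) sequentially"
    by (rule eventually_conj)
  then obtain n where n: "\<And>k. n \<le> k \<Longrightarrow> dist (w ((1/2)^k)) l < \<epsilon>/2"
    "\<And>k. n \<le> k \<Longrightarrow> y k < ennreal ((\<epsilon>/2)^4)"
    by (auto simp: eventually_sequentially)
  have "dist (w t) l < \<epsilon>" if t: "0 < t" "t < (1/2)^n" for t
  proof -
    obtain k where k: "n \<le> k" "(1/2)^Suc k \<le> t" "t \<le> 2 * (1/2)^Suc k"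
      using dyadic_block[OF t] by blast
    have "ennreal ((w t - w ((1/2)^Suc k))^4) < ennreal ((\<epsilon>/2)^4)"
      using osc[OF k(2,3)] n(2)[OF k(1)] by (rule le_less_trans)
    then have "\<bar>w t - w ((1/2)^Suc k)\<bar>^4 < (\<epsilon>/2)^4"
      by (simp add: ennreal_less_iff power_even_abs)
    then have "\<bar>w t - w ((1/2)^Suc k)\<bar> < \<epsilon>/2"
      by (rule power_less_imp_less_base) (use \<epsilon> in simp)
    moreover have "\<bar>w ((1/2)^Suc k) - l\<bar> < \<epsilon>/2"
      using n(1)[of "Suc k"] k(1) by (simp only: dist_real_def)
    ultimately show ?thesis unfolding dist_real_def by linarith
  qed
  then show "eventually (\<lambda>t. dist (w t) l < \<epsilon>) (at_right 0)"
    unfolding eventually_at_right_field by (intro exI[of _ "(1/2)^n"]) auto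
qed

text \<open>The process is normalized by \<open>t + f t\<close> instead of \<open>f t\<close>, which makes all one-dimensional marginals equal and the fourth moment
estimate clean; the estimate is then weakened to one in terms of \<open>f\<close>, to which the integral
condition and the monotonicity lemmas apply directly.\<close>
lemma permanental_normalized_limit:
  fixes f :: "real \<Rightarrow> real"
  assumes \<alpha>: "0 < \<alpha>" and f: "positive_concave f"
    and \<delta>: "0 < \<delta>" "(\<integral>\<^sup>+u\<in>{0<..<\<delta>}. ennreal (1 / (f u * sqrt (ln (1 / u)))) \<partial>lborel) < \<infinity>"
    and perm: "permanental_process M \<alpha> {0<..} (u_tilde f) Z"
    and cont: "continuous_paths M {0<..} Z"
  obtains \<xi> where "distributed M lborel \<xi> (\<lambda>x. ennreal (gamma_density \<alpha> x))"
    "AE \<omega> in M. ((\<lambda>t. Z t \<omega> / f t) \<longlongrightarrow> \<xi> \<omega>) (at_right 0)"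
proof -
  interpret prob_space M by (rule permanental_process_prob_space[OF perm])
  have conc: "concave_on {0<..} f" and pos: "\<And>t. 0 < t \<Longrightarrow> 0 < f t"
    using f by (auto simp: positive_concave_def)
  note mono = positive_concave_mono[OF conc pos]
  define W where "W t \<omega> = Z t \<omega> / (t + f t)" for t \<omega>
  define K where "K = 16 * \<alpha> * (\<alpha> + 1)"
  have K: "0 \<le> K" using \<alpha> by (simp add: K_def)
  define p where "p k = (1/2)^k / f ((1/2)^k)" for k :: nat
  have p0: "0 \<le> p k" for k using pos[of "(1/2)^k"] by (simp add: p_def less_imp_le)
  have "antimono p"
  proof (rule antimonoI)
    fix i j :: nat assume "i \<le> j"
    then have "(1/2::real)^j \<le> (1/2)^i" by (rule power_decreasing) auto
    then show "p j \<le> p i" unfolding p_def by (intro positive_concave_ratio_mono[OF conc pos]) auto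
  qed
  moreover have "summable (\<lambda>k. p k / sqrt (real k + 1))"
    unfolding p_def by (rule dyadic_summable_of_integral[OF mono pos \<delta>])
  ultimately have p_sq: "summable (\<lambda>k. (p k)\<^sup>2)" using p0 by (intro summable_square_of_weighted)
  have p_lim: "p \<longlonglongrightarrow> 0"
    using tendsto_real_sqrt[OF summable_LIMSEQ_zero[OF p_sq]] p0 by simp

  have Wm [measurable]: "W t \<in> borel_measurable M" if "0 < t" for t
    unfolding W_def using permanental_process_measurable(1)[OF perm] that by simp
  have W0: "0 \<le> W t \<omega>" if "0 < t" "\<omega> \<in> space M" for t \<omega>
    unfolding W_def using permanental_process_measurable(2)[OF perm] pos[of t] that by simp
  have W_cont: "continuous_on {0<..} (\<lambda>t. W t \<omega>)" if "\<omega> \<in> space M" for \<omega>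
  proof -
    have "continuous_on {0<..} (\<lambda>t. - f t)"
      using conc unfolding concave_on_def by (intro convex_on_continuous) auto
    then have "continuous_on {0<..} f" using continuous_on_minus by fastforce
    moreover have "t + f t \<noteq> 0" if "t \<in> {0<..}" for t using pos[of t] that by auto
    ultimately show ?thesis
      unfolding W_def using cont that
      by (auto intro!: continuous_intros simp: continuous_paths_def)
  qed
  have mom: "(\<integral>\<^sup>+\<omega>. ennreal ((W s \<omega> - W t \<omega>)^4) \<partial>M) \<le> ennreal (K * ((t - s) / f r)\<^sup>2)"
    if "0 < s" "s < t" "0 < r" "r \<le> t" for r s t
  proof -
    have "(\<integral>\<^sup>+\<omega>. ennreal ((W s \<omega> - W t \<omega>)^4) \<partial>M) \<le> ennreal (K * ((t - s) / (t + f t))\<^sup>2)"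
      unfolding W_def K_def using that by (intro u_tilde_fourth_moment[OF \<alpha> perm] pos) auto
    also have "\<dots> \<le> ennreal (K * ((t - s) / f r)\<^sup>2)"
      using that mono[of r t] pos[of r] pos[of t] K
      by (intro ennreal_leI mult_left_mono power_mono divide_left_mono) auto
    finally show ?thesis .
  qed

  define X where "X k = W ((1/2)^k)" for k :: nat
  have Xm [measurable]: "X k \<in> borel_measurable M" for k unfolding X_def by simp
  have conv: "AE \<omega> in M. convergent (\<lambda>k. X k \<omega>)"
  proof (rule AE_convergent_of_fourth_moments)
    fix k n :: nat assume "k \<le> n"
    show "(\<integral>\<^sup>+\<omega>. ennreal ((X k \<omega> - X n \<omega>)^4) \<partial>M) \<le> ennreal (K * (p k)\<^sup>2)"
    proof (cases "k = n")
      case False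
      let ?s = "(1/2::real)^n" and ?t = "(1/2::real)^k"
      have st: "0 < ?s" "?s < ?t" using \<open>k \<le> n\<close> False by (auto intro!: power_strict_decreasing)
      have "(X k \<omega> - X n \<omega>)^4 = (W ?s \<omega> - W ?t \<omega>)^4" for \<omega>
        using power_even_abs[of 4 "X k \<omega> - X n \<omega>"] power_even_abs[of 4 "X n \<omega> - X k \<omega>"]
        by (simp add: X_def abs_minus_commute)
      then have "(\<integral>\<^sup>+\<omega>. ennreal ((X k \<omega> - X n \<omega>)^4) \<partial>M) \<le> ennreal (K * ((?t - ?s) / f ?t)\<^sup>2)"
        using mom[OF st, of ?t] st by simp
      also have "\<dots> \<le> ennreal (K * (p k)\<^sup>2)"
        unfolding p_def using st pos[of ?t] K
        by (intro ennreal_leI mult_left_mono power_mono divide_right_mono) auto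
      finally show ?thesis .
    qed (simp add: K)
  qed (use K p_sq in \<open>auto intro: summable_mult\<close>)
  define \<xi> where "\<xi> \<omega> = lim (\<lambda>k. X k \<omega>)" for \<omega>
  have [measurable]: "\<xi> \<in> borel_measurable M" unfolding \<xi>_def by measurable
  have X_lim: "AE \<omega> in M. (\<lambda>k. X k \<omega>) \<longlonglongrightarrow> \<xi> \<omega>"
    using conv by eventually_elim (simp add: \<xi>_def convergent_LIMSEQ_iff)

  \<comment> \<open>\<open>Y k\<close> will dominate the fourth power of the oscillation of \<open>W\<close> over the \<open>k\<close>-th dyadic block\<close>
  define Q where "Q k Y \<longleftrightarrow> Y \<in> borel_measurable M \<and>
      (\<integral>\<^sup>+\<omega>. Y \<omega> \<partial>M) \<le> ennreal (50000 * (K * (p (Suc k))\<^sup>2)) \<and>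
      (\<forall>\<omega>\<in>space M. \<forall>t\<in>{(1/2)^Suc k..2 * (1/2)^Suc k}.
        ennreal ((W t \<omega> - W ((1/2)^Suc k) \<omega>)^4) \<le> Y \<omega>)" for k Y
  have "\<exists>Y. Q k Y" for k
  proof -
    define a where "a = (1/2::real)^Suc k"
    have a: "0 < a" by (simp add: a_def)
    have pk: "p (Suc k) = a / f a" by (simp only: p_def a_def)
    have C: "0 \<le> K * (p (Suc k))\<^sup>2" using K by simp
    have i: "(\<integral>\<^sup>+\<omega>. ennreal ((W s \<omega> - W t \<omega>)^4) \<partial>M) \<le> ennreal (K * (p (Suc k))\<^sup>2 * ((t - s) / a)\<^sup>2)"
      if "a \<le> s" "s < t" "t \<le> 2 * a" for s t
    proof -
      have "K * (p (Suc k))\<^sup>2 * ((t - s) / a)\<^sup>2 = K * ((t - s) / f a)\<^sup>2"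
        unfolding pk using a by (simp add: power_mult_distrib power_divide)
      then show ?thesis using mom[of s t a] that a by (simp only:)
    qed
    have c: "continuous_on {a..2*a} (\<lambda>t. W t \<omega>)" if "\<omega> \<in> space M" for \<omega>
      using a by (intro continuous_on_subset[OF W_cont[OF that]]) auto
    have m: "W t \<in> borel_measurable M" if "t \<in> {a..2*a}" for t using that a by (intro Wm) simp
    show ?thesis
    proof (rule chaining_fourth_moment[where W = W and M = M, OF a C m c i])
      fix Y assume "Y \<in> borel_measurable M" "(\<integral>\<^sup>+\<omega>. Y \<omega> \<partial>M) \<le> ennreal (50000 * (K * (p (Suc k))\<^sup>2))"
        "\<And>\<omega> t. \<omega> \<in> space M \<Longrightarrow> t \<in> {a..2*a} \<Longrightarrow> ennreal ((W t \<omega> - W a \<omega>)^4) \<le> Y \<omega>"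
      then have "Q k Y" unfolding Q_def a_def[symmetric] by blast
      then show "\<exists>Y. Q k Y" by (rule exI[of "Q k"])
    qed
  qed
  then obtain Y where Q: "\<And>k. Q k (Y k)" by metis
  have Ym [measurable]: "Y k \<in> borel_measurable M" for k
    using Q[of k] by (simp only: Q_def)
  have Y_int: "(\<integral>\<^sup>+\<omega>. Y k \<omega> \<partial>M) \<le> ennreal (50000 * (K * (p (Suc k))\<^sup>2))" for k
    using Q[of k] by (simp only: Q_def)
  have Y_osc: "ennreal ((W t \<omega> - W ((1/2)^Suc k) \<omega>)^4) \<le> Y k \<omega>"
    if "\<omega> \<in> space M" "t \<in> {(1/2)^Suc k..2 * (1/2)^Suc k}" for k \<omega> t
    using Q[of k] that by (simp only: Q_def)
  have "AE \<omega> in M. (\<lambda>k. Y k \<omega>) \<longlonglongrightarrow> 0"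
  proof (rule AE_tendsto_zero_of_summable_integrals)
    have "summable (\<lambda>k. 50000 * (K * (p (Suc k))\<^sup>2))"
      using p_sq summable_Suc_iff[of "\<lambda>k. (p k)\<^sup>2"] by (intro summable_mult) simp
    then have "(\<Sum>k. ennreal (50000 * (K * (p (Suc k))\<^sup>2))) < \<infinity>"
      using K by (simp add: suminf_ennreal2)
    moreover have "(\<Sum>k. \<integral>\<^sup>+\<omega>. Y k \<omega> \<partial>M) \<le> (\<Sum>k. ennreal (50000 * (K * (p (Suc k))\<^sup>2)))"
      using Y_int by (intro suminf_le) auto
    ultimately show "(\<Sum>k. \<integral>\<^sup>+\<omega>. Y k \<omega> \<partial>M) < \<infinity>" by (rule le_less_trans[rotated])
  qed simp
  then have W_lim: "AE \<omega> in M. ((\<lambda>t. W t \<omega>) \<longlongrightarrow> \<xi> \<omega>) (at_right 0)"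
    using X_lim AE_space
  proof eventually_elim
    case (elim \<omega>)
    then show ?case
      using Y_osc[OF elim(3)] by (intro limit_along_dyadic_blocks[of _ _ "\<lambda>k. Y k \<omega>"]) (auto simp: X_def)
  qed

  have ratio: "((\<lambda>t. t / f t) \<longlongrightarrow> 0) (at_right 0)"
  proof (rule tendstoI)
    fix \<epsilon> :: real assume "0 < \<epsilon>"
    then obtain n where n: "p n < \<epsilon>"
      using order_tendstoD(2)[OF p_lim] by (auto simp: eventually_sequentially)
    have "dist (t / f t) 0 < \<epsilon>" if "0 < t" "t < (1/2)^n" for t
    proof -
      have "t / f t \<le> p n"
        unfolding p_def using that by (intro positive_concave_ratio_mono[OF conc pos]) auto
      moreover have "0 \<le> t / f t" using pos[of t] that by simp
      ultimately show ?thesis using n by (simp add: dist_real_def)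
    qed
    then show "eventually (\<lambda>t. dist (t / f t) 0 < \<epsilon>) (at_right 0)"
      unfolding eventually_at_right_field by (intro exI[of _ "(1/2)^n"]) auto
  qed
  have "AE \<omega> in M. ((\<lambda>t. Z t \<omega> / f t) \<longlongrightarrow> \<xi> \<omega>) (at_right 0)"
    using W_lim
  proof eventually_elim
    case (elim \<omega>)
    have "((\<lambda>t. W t \<omega> * (1 + t / f t)) \<longlongrightarrow> \<xi> \<omega> * (1 + 0)) (at_right 0)"
      by (intro tendsto_mult tendsto_add tendsto_const elim ratio)
    moreover have "eventually (\<lambda>t. W t \<omega> * (1 + t / f t) = Z t \<omega> / f t) (at_right 0)"
      unfolding eventually_at_right_field
    proof (intro exI[of _ 1] conjI allI impI)
      fix t :: real assume "0 < t" "t < 1"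
      then have "0 < f t" "t + f t \<noteq> 0" using pos[of t] by auto
      moreover from this have "1 + t / f t = (t + f t) / f t" by (simp add: add_divide_distrib)
      ultimately show "W t \<omega> * (1 + t / f t) = Z t \<omega> / f t" by (simp add: W_def)
    qed simp
    ultimately have "((\<lambda>t. Z t \<omega> / f t) \<longlongrightarrow> \<xi> \<omega> * (1 + 0)) (at_right 0)"
      by (rule Lim_transform_eventually)
    then show ?case by simp
  qed
  moreover have "distributed M lborel \<xi> (\<lambda>x. ennreal (gamma_density \<alpha> x))"
  proof (rule distributed_gamma_of_laplace[OF \<alpha>])
    show "AE \<omega> in M. 0 \<le> \<xi> \<omega>"
      using X_lim AE_space
    proof eventually_elim
      case (elim \<omega>)
      then show ?case by (intro LIMSEQ_le_const[OF elim(1)]) (auto simp: X_def W0)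
    qed
    fix k :: nat
    show "(\<integral>\<omega>. exp (- (real k * \<xi> \<omega>)) \<partial>M) = (1 + real k) powr (-\<alpha>)"
    proof (cases "k = 0")
      case True
      then show ?thesis using prob_space by simp
    next
      case False
      have const: "(\<integral>\<omega>. exp (- (real k * X n \<omega>)) \<partial>M) = (1 + real k) powr (-\<alpha>)" for n
        unfolding X_def W_def using False by (intro u_tilde_laplace_one[OF perm] pos) auto
      have "(\<lambda>n. \<integral>\<omega>. exp (- (real k * X n \<omega>)) \<partial>M) \<longlonglongrightarrow> (\<integral>\<omega>. exp (- (real k * \<xi> \<omega>)) \<partial>M)"
      proof (rule integral_dominated_convergence[where w = "\<lambda>_. 1"])
        show "AE \<omega> in M. (\<lambda>n. exp (- (real k * X n \<omega>))) \<longlonglongrightarrow> exp (- (real k * \<xi> \<omega>))"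
          using X_lim by eventually_elim (intro tendsto_intros)
        show "AE \<omega> in M. norm (exp (- (real k * X n \<omega>))) \<le> 1" for n
          by (intro AE_I2) (simp add: X_def W0)
      qed auto
      then show ?thesis unfolding const by (rule LIMSEQ_unique[OF tendsto_const, symmetric])
    qed
  qed simp
  ultimately show thesis using that by blast
qed

theorem theorem1p13:
  fixes \<alpha> :: real and f :: "real \<Rightarrow> real"
    and M :: "'a measure" and Z :: "real \<Rightarrow> 'a \<Rightarrow> real"
  assumes "\<alpha> > 0"
    and "positive_concave f"
    and "\<exists>\<delta>>0. (\<integral>\<^sup>+u\<in>{0<..<\<delta>}. ennreal (1 / (f u * sqrt (ln (1 / u)))) \<partial>lborel) < \<infinity>"
    and "permanental_process M \<alpha> {0<..} (u_tilde f) Z"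
    and "continuous_paths M {0<..} Z"
  shows "\<exists>(N :: ((real \<Rightarrow> real) \<times> real) measure) (Z' :: real \<Rightarrow> (real \<Rightarrow> real) \<times> real \<Rightarrow> real)
            (\<xi> :: (real \<Rightarrow> real) \<times> real \<Rightarrow> real).
           prob_space N \<and>
           permanental_process N \<alpha> {0<..} (u_tilde f) Z' \<and>
           continuous_paths N {0<..} Z' \<and>
           process_law N {0<..} Z' = process_law M {0<..} Z \<and>
           distributed N lborel \<xi> (\<lambda>x. ennreal (gamma_density \<alpha> x)) \<and>
           (AE \<omega> in N. ((\<lambda>t. Z' t \<omega> / f t) \<longlongrightarrow> \<xi> \<omega>) (at_right 0))"
proof -
  obtain \<delta> where \<delta>: "0 < \<delta>"
    "(\<integral>\<^sup>+u\<in>{0<..<\<delta>}. ennreal (1 / (f u * sqrt (ln (1 / u)))) \<partial>lborel) < \<infinity>"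
    using assms(3) by blast
  show ?thesis
  proof (rule permanental_normalized_limit[OF assms(1,2) \<delta> assms(4,5)])
    fix \<xi> assume "distributed M lborel \<xi> (\<lambda>x. ennreal (gamma_density \<alpha> x))"
      "AE \<omega> in M. ((\<lambda>t. Z t \<omega> / f t) \<longlongrightarrow> \<xi> \<omega>) (at_right 0)"
    then show ?thesis by (rule coupling_of_AE_limit[OF assms(4,5)])
  qed
qed

end
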